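(* In the setting below, let $\lambda\in\mathcal P_n$ with $\lambda\ne h(\lambda)$ and suppose $\lambda$ is not almost $\ell$-symmetric. Then for any two $2\ell$-good nodes $B,C$ of $\lambda$, $\lambda\setminus B\ne h(\lambda\setminus C)$.
   Context: $K$ is a field with $\mathrm{char}\,K\ne2$, $q\in K^\times$ a primitive $2\ell$-th root of unity, type $D$ Hecke algebras split over $K$. $\mathcal H(B_m)$ is the $K$-algebra with generators $T_0,\dots,T_{m-1}$ and relations $T_0^2=1$; $(T_i+1)(T_i-q)=0$ for $1\le i\le m-1$; $T_0T_1T_0T_1=T_1T_0T_1T_0$; $T_iT_{i+1}T_i=T_{i+1}T_iT_{i+1}$; $T_iT_j=T_jT_i$ for $|i-j|>1$. For a bipartition $\lambda$ of $m$, $\tilde D^\lambda$ is the simple head of the Dipper–James–Mathas Specht module and $\mathcal P_m=\{\lambda:\tilde D^\lambda\ne0\}$, the set of Kleshchev bipartitions for parameters $(q;1,-1)$. Residues of nodes (in $\mathbb Z/2\ell\mathbb Z$) and $2\ell$-good nodes are as in Ariki–Mathas for Ariki–Koike parameters $(q;1,-1)$; distinct good nodes of a bipartition have distinct residues. With $\sigma(T_0)=-T_0$, $\sigma(T_i)=T_i$ ($i\ne0$), $h$ is the involution of $\mathcal P_m$ with $(\tilde D^\lambda)^\sigma\cong\tilde D^{h(\lambda)}$; if $\underline\emptyset\xrightarrow{i_1}\cdots\xrightarrow{i_m}\lambda$ is a path in Kleshchev's good lattice (arrows = adding a $2\ell$-good node of the given residue) then $\underline\emptyset\xrightarrow{i_1+\ell}\cdots\xrightarrow{i_m+\ell}h(\lambda)$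 is one too. $\lambda$ is almost $\ell$-symmetric if it has a $2\ell$-good node $A$ with $\lambda\setminus A=h(\lambda\setminus A)$; $\lambda\setminus A$ is the bipartition obtained by removing $A$. *)

theory Defs
  imports Main
begin

text \<open>Nodes of a bipartition: (row, column, component), rows/columns from 1,
  component 1 or 2. A bipartition is identified with its Young diagram (set of nodes).\<close>

type_synonym node = "nat \<times> nat \<times> nat"

definition is_bipartition :: "node set \<Rightarrow> bool" where
  "is_bipartition Y \<longleftrightarrow> finite Y \<and>
     (\<forall>(r,c,k)\<in>Y. 1 \<le> r \<and> 1 \<le> c \<and> (k = 1 \<or> k = 2)) \<and>
     (\<forall>r c k r' c'. (r,c,k) \<in> Y \<longrightarrow> 1 \<le> r' \<longrightarrow> r' \<le> r \<longrightarrow> 1 \<le> c' \<longrightarrow> c' \<le> c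
        \<longrightarrow> (r',c',k) \<in> Y)"

definition addable :: "node set \<Rightarrow> node \<Rightarrow> bool" where
  "addable Y x \<longleftrightarrow> x \<notin> Y \<and> is_bipartition (insert x Y)"

definition removable :: "node set \<Rightarrow> node \<Rightarrow> bool" where
  "removable Y x \<longleftrightarrow> x \<in> Y \<and> is_bipartition (Y - {x})"

text \<open>Residue for Ariki--Koike parameters (q; Q_1, Q_2) = (q; 1, -1) = (q; q^0, q^l):
  res (r,c,k) = c - r + s_k  in Z/2lZ with s_1 = 0, s_2 = l (represented in {0..2l-1}).\<close>

definition res :: "nat \<Rightarrow> node \<Rightarrow> int" where
  "res l x = (case x of (r,c,k) \<Rightarrow>
      (int c - int r + (if k = 2 then int l else 0)) mod (2 * int l))"

definition below :: "node \<Rightarrow> node \<Rightarrow> bool" where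
  "below x y \<longleftrightarrow> (case x of (r,c,k) \<Rightarrow> case y of (r',c',k') \<Rightarrow>
      k > k' \<or> (k = k' \<and> r > r'))"

definition normal :: "nat \<Rightarrow> node set \<Rightarrow> int \<Rightarrow> node \<Rightarrow> bool" where
  "normal l Y i x \<longleftrightarrow> removable Y x \<and> res l x = i \<and>
     (\<forall>y. addable Y y \<and> res l y = i \<and> below y x \<longrightarrow>
        card {z. removable Y z \<and> res l z = i \<and> below y z \<and> below z x}
        > card {z. addable Y z \<and> res l z = i \<and> below y z \<and> below z x})"

definition good :: "nat \<Rightarrow> node set \<Rightarrow> node \<Rightarrow> bool" where
  "good l Y x \<longleftrightarrow> normal l Y (res l x) x \<and>
     (\<forall>z. normal l Y (res l x) z \<longrightarrow> z = x \<or> below z x)"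

text \<open>Paths in Kleshchev's good lattice starting at the empty bipartition,
  recorded by the sequence of residues of the added good nodes.\<close>

inductive reach :: "nat \<Rightarrow> int list \<Rightarrow> node set \<Rightarrow> bool" for l where
  reach_empty: "reach l [] {}"
| reach_step: "reach l is Y \<Longrightarrow> x \<notin> Y \<Longrightarrow> good l (insert x Y) x \<Longrightarrow>
     reach l (is @ [res l x]) (insert x Y)"

definition kleshchev :: "nat \<Rightarrow> node set \<Rightarrow> bool" where
  "kleshchev l Y \<longleftrightarrow> (\<exists>is. reach l is Y)"

definition shift :: "nat \<Rightarrow> int \<Rightarrow> int" where
  "shift l i = (i + int l) mod (2 * int l)"

text \<open>Properties of the involution h from the context: h is an involution on the
  Kleshchev bipartitions, and shifting all residues of a path to lambda by l gives a
  path to h(lambda). These determine h uniquely on Kleshchev bipartitions.\<close>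

definition is_h :: "nat \<Rightarrow> (node set \<Rightarrow> node set) \<Rightarrow> bool" where
  "is_h l h \<longleftrightarrow>
     (\<forall>Y. kleshchev l Y \<longrightarrow> kleshchev l (h Y) \<and> card (h Y) = card Y \<and> h (h Y) = Y) \<and>
     (\<forall>is Y. reach l is Y \<longrightarrow> reach l (map (shift l) is) (h Y))"

definition almost_symmetric :: "nat \<Rightarrow> (node set \<Rightarrow> node set) \<Rightarrow> node set \<Rightarrow> bool" where
  "almost_symmetric l h Y \<longleftrightarrow> (\<exists>A. good l Y A \<and> Y - {A} = h (Y - {A}))"

end

(* Write i and j for the residues of B and C. If lam - {B} = h (lam - {C}), comparing the residue
   contents of lam - {B} and lam - {C} forces {i, i + l} = {j, j + l}, so j = i + l. Then one and the
   same residue sequence leads to both lam and h lam, whence lam = h lam.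

   The argument needs that removing a good node from a Kleshchev bipartition leaves a Kleshchev
   bipartition. For l >= 2 this follows from local confluence of good node removal, as in
   Stembridge's axioms for simply laced crystals: a bipartition is encoded by the sequence of its
   shifted row lengths, and the good i-node is the first minimum of a height function. For l = 1
   (type A_1^(1)) there is no local relation, but the Kleshchev bipartitions have an explicit
   description that is stable under adding and removing good nodes.

   The inductive definition of reach lets the last step add a node that does not give a
   bipartition; such a set has a single removable node, so it cannot interfere. *)

theory Submission
  imports Defs
begin

text \<open>Whether a row end is really addable or removable depends on the neighbouring row, so
  removing one node can change several signature entries. The remedy is to credit every row with
  both ends, real or not. Fictitious ends cancel between adjacent rows of equal length, and the
  height function becomes a sum over the letters of a word plus a fixed boundary term. Removing a
  node changes one letter only, and each height by a Cartan integer times a step function. For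
  \<open>l \<ge> 2\<close> the residues \<open>i - 1\<close> and \<open>i + 1\<close> differ modulo
  \<open>2 * l\<close>, these integers are 2, -1 and 0, and confluence is a statement about two
  integer functions. For \<open>l = 1\<close> the neighbours coincide and the integer is -2, which
  the local argument does not cover. Confluence is proved for arbitrary bipartitions. Since every
  removal lowers the number of nodes, a Newman-style induction shows that the empty bipartition
  stays reachable after any good removal. Conversely, the removed slot is the last minimum of the
  new height function, so residues also determine how a node is put back.\<close>

section \<open>Words and local confluence\<close>

text \<open>Indexed by the step \<open>p\<close> that enters the first minimum, not by the minimum
  itself: this step is the slot of the good node. A minimum at position 0 is excluded, which encodes
  that there is no good node.\<close>

definition first_min :: "nat \<Rightarrow> (nat \<Rightarrow> int) \<Rightarrow> nat \<Rightarrow> bool" where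
  "first_min M f p \<longleftrightarrow> p < M \<and> (\<forall>n\<le>p. f (Suc p) < f n) \<and> (\<forall>n\<le>M. f (Suc p) \<le> f n)"

lemma first_min_unique:
  assumes "first_min M f p" "first_min M f q"
  shows "p = q"
proof -
  have "False" if "a < b" "first_min M f a" "first_min M f b" for a b
    using that unfolding first_min_def by (meson Suc_leI leD)
  then show ?thesis using assms by (metis linorder_neqE_nat)
qed

lemma first_min_exists:
  assumes "n \<le> M" "f n < f 0"
  shows "\<exists>p. first_min M f p"
proof -
  define m where "m = Min (f ` {..M})"
  have m_le: "m \<le> f k" if "k \<le> M" for k using that by (simp add: m_def)
  have "m \<in> f ` {..M}" unfolding m_def by (rule Min_in) auto
  then obtain k where k: "k \<le> M" "f k = m" by auto
  define k0 where "k0 = (LEAST k. f k = m)"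
  have k0: "f k0 = m" unfolding k0_def by (rule LeastI, rule k)
  have k0_least: "f j \<noteq> m" if "j < k0" for j using that not_less_Least unfolding k0_def by blast
  have "k0 \<le> k" unfolding k0_def by (rule Least_le, rule k)
  have "k0 \<noteq> 0" using assms m_le k0 by (metis leD)
  then obtain p where p: "k0 = Suc p" using not0_implies_Suc by blast
  have "f (Suc p) < f j" if "j \<le> p" for j
    using k0_least[of j] m_le[of j] k0 p that \<open>k0 \<le> k\<close> k(1) by auto
  then have "first_min M f p"
    unfolding first_min_def using p k0 \<open>k0 \<le> k\<close> k(1) m_le by auto
  then show ?thesis ..
qed

definition bump :: "nat \<Rightarrow> nat \<Rightarrow> int" where
  "bump p n = of_bool (p < n)"

definition dec :: "nat \<Rightarrow> (nat \<Rightarrow> int) \<Rightarrow> nat \<Rightarrow> int" where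
  "dec p g = g(p := g p - 1)"

lemma dec_commute: "dec p (dec q g) = dec q (dec p g)"
  by (auto simp: dec_def fun_eq_iff)

text \<open>The signature entry of a row whose last node has unreduced residue \<open>v\<close>: a
  possibly fictitious addable end of residue \<open>v + 1\<close> counts +1, a possibly fictitious
  removable end of residue \<open>v\<close> counts -1.\<close>

definition dstep :: "int \<Rightarrow> int \<Rightarrow> int \<Rightarrow> int" where
  "dstep e i v = of_bool ((v + 1) mod e = i) - of_bool (v mod e = i)"

text \<open>The local part of Stembridge's theorem for type \<open>A\<^sub>2\<close>: \<open>f\<close> and \<open>k\<close> are the height
  functions of two adjacent residues, and removing a node in slot \<open>p\<close> for the first residue turns
  \<open>f\<close> into \<open>f + 2 bump p\<close> and \<open>k\<close> into \<open>k - bump p\<close>.\<close>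

lemma first_min_confluent:
  assumes f: "first_min M f p" and k: "first_min M k q" and pq: "p < q"
    and drop: "k q = k (Suc q) + 1"
  shows "first_min M (\<lambda>n. k n - bump p n) q"
    and "first_min M (\<lambda>n. f n - bump q n) p \<or>
    (\<exists>r s. first_min M (\<lambda>n. k n - bump p n + 2 * bump q n) s \<and>
       first_min M (\<lambda>n. f n + 2 * bump p n - bump q n - bump s n) r \<and>
       first_min M (\<lambda>n. f n - bump q n) r \<and>
       first_min M (\<lambda>n. f n - bump q n + 2 * bump r n) p \<and>
       first_min M (\<lambda>n. k n + 2 * bump q n - bump r n - bump p n) s)"
proof -
  have pM: "p < M" and f1: "\<And>n. n \<le> p \<Longrightarrow> f (Suc p) + 1 \<le> f n"
    and f2: "\<And>n. n \<le> M \<Longrightarrow> f (Suc p) \<le> f n" using f unfolding first_min_def by auto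
  have qM: "q < M" and k1: "\<And>n. n \<le> q \<Longrightarrow> k (Suc q) + 1 \<le> k n"
    and k2: "\<And>n. n \<le> M \<Longrightarrow> k (Suc q) \<le> k n" using k unfolding first_min_def by auto
  show "first_min M (\<lambda>n. k n - bump p n) q"
    unfolding first_min_def
  proof (intro conjI allI impI)
    show "q < M" by fact
    fix n
    show "k (Suc q) - bump p (Suc q) < k n - bump p n" if "n \<le> q"
      using that pq k1[of n] by (cases "p < n") (auto simp: bump_def)
    show "k (Suc q) - bump p (Suc q) \<le> k n - bump p n" if "n \<le> M"
      using that pq k2[of n] by (cases "p < n") (auto simp: bump_def)
  qed
  show "first_min M (\<lambda>n. f n - bump q n) p \<or>
    (\<exists>r s. first_min M (\<lambda>n. k n - bump p n + 2 * bump q n) s \<and>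
       first_min M (\<lambda>n. f n + 2 * bump p n - bump q n - bump s n) r \<and>
       first_min M (\<lambda>n. f n - bump q n) r \<and>
       first_min M (\<lambda>n. f n - bump q n + 2 * bump r n) p \<and>
       first_min M (\<lambda>n. k n + 2 * bump q n - bump r n - bump p n) s)"
  \<comment> \<open>Removing \<open>q\<close> lowers \<open>f\<close> by 1 beyond \<open>q\<close>.
    The first minimum of \<open>f\<close> moves exactly if the value \<open>f (Suc p)\<close> recurs
    there; otherwise the two removals commute.\<close>
  proof (cases "\<exists>n. q < n \<and> n \<le> M \<and> f n = f (Suc p)")
    case False
    then have "\<And>n. q < n \<Longrightarrow> n \<le> M \<Longrightarrow> f (Suc p) + 1 \<le> f n" using f2 by force
    then have "first_min M (\<lambda>n. f n - bump q n) p"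
      unfolding first_min_def bump_def using pq pM f1 f2 by (force simp: of_bool_def)
    then show ?thesis ..
  next
    case True
    \<comment> \<open>The step \<open>r\<close> enters the first recurrence of the minimum beyond
      \<open>q\<close>, which becomes the first minimum of \<open>f\<close> once \<open>q\<close> is
      removed.\<close>
    define n0 where "n0 = (LEAST n. q < n \<and> n \<le> M \<and> f n = f (Suc p))"
    have n0: "q < n0 \<and> n0 \<le> M \<and> f n0 = f (Suc p)"
      unfolding n0_def using True by (rule LeastI_ex)
    obtain r where r: "n0 = Suc r" using n0 by (cases n0) auto
    have r_eq: "q \<le> r" "r < M" "f (Suc r) = f (Suc p)" using n0 r by auto
    have r_least: "f (Suc p) + 1 \<le> f n" if "q < n" "n \<le> r" for n
    proof -
      have "n < n0" using that r by simp
      then have "f n \<noteq> f (Suc p)" using that r_eq(2) not_less_Least[of n "\<lambda>n. q < n \<and> n \<le> M \<and> f n = f (Suc p)"]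
        unfolding n0_def by auto
      then show ?thesis using f2[of n] that r_eq by force
    qed
    \<comment> \<open>The step \<open>s\<close> is the next slot for \<open>k\<close> after
      \<open>p\<close> and \<open>q\<close> are removed. The new height has minimum
      \<open>k (Suc q)\<close>, attained exactly at those \<open>n\<close> with \<open>p < n\<close>
      and \<open>n \<le> q\<close> where \<open>k n = k q\<close>; by \<open>drop\<close> the
      position \<open>q\<close> is one of them.\<close>
    define n1 where "n1 = (LEAST n. p < n \<and> k n = k q)"
    have n1: "p < n1 \<and> k n1 = k q" unfolding n1_def by (rule LeastI[of _ q]) (simp add: pq)
    have "n1 \<le> q" unfolding n1_def by (rule Least_le) (simp add: pq)
    obtain s where s: "n1 = Suc s" using n1 by (cases n1) auto
    have s_eq: "p \<le> s" "s < q" "k (Suc s) = k (Suc q) + 1" using n1 s \<open>n1 \<le> q\<close> drop by auto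
    have s_least: "k (Suc q) + 2 \<le> k n" if "p < n" "n \<le> s" for n
    proof -
      have "n < n1" using that s by simp
      then have "k n \<noteq> k q" using that(1) unfolding n1_def by (blast dest: not_less_Least)
      then show ?thesis using k1[of n] that s_eq drop by force
    qed
    have "first_min M (\<lambda>n. k n - bump p n + 2 * bump q n) s"
      unfolding first_min_def
    proof (intro conjI allI impI)
      show "s < M" using s_eq qM by simp
      fix n
      show "k (Suc s) - bump p (Suc s) + 2 * bump q (Suc s) < k n - bump p n + 2 * bump q n" if "n \<le> s"
        using that s_eq k1[of n] s_least[of n] by (cases "p < n") (auto simp: bump_def)
      show "k (Suc s) - bump p (Suc s) + 2 * bump q (Suc s) \<le> k n - bump p n + 2 * bump q n" if "n \<le> M"
        using that s_eq pq k1[of n] k2[of n] by (cases "p < n"; cases "q < n") (auto simp: bump_def)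
    qed
    moreover have "first_min M (\<lambda>n. f n + 2 * bump p n - bump q n - bump s n) r"
      unfolding first_min_def
    proof (intro conjI allI impI)
      show "r < M" by fact
      fix n
      show "f (Suc r) + 2 * bump p (Suc r) - bump q (Suc r) - bump s (Suc r)
          < f n + 2 * bump p n - bump q n - bump s n" if "n \<le> r"
        using that s_eq pq r_eq f1[of n] f2[of n] r_least[of n]
        by (cases "p < n"; cases "q < n"; cases "s < n") (auto simp: bump_def)
      show "f (Suc r) + 2 * bump p (Suc r) - bump q (Suc r) - bump s (Suc r)
          \<le> f n + 2 * bump p n - bump q n - bump s n" if "n \<le> M"
        using that s_eq pq r_eq f1[of n] f2[of n]
        by (cases "p < n"; cases "q < n"; cases "s < n") (auto simp: bump_def)
    qed
    moreover have "first_min M (\<lambda>n. f n - bump q n) r"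
      unfolding first_min_def
    proof (intro conjI allI impI)
      show "r < M" by fact
      fix n
      show "f (Suc r) - bump q (Suc r) < f n - bump q n" if "n \<le> r"
        using that pq r_eq f2[of n] r_least[of n] by (cases "q < n") (auto simp: bump_def)
      show "f (Suc r) - bump q (Suc r) \<le> f n - bump q n" if "n \<le> M"
        using that pq r_eq f2[of n] by (cases "q < n") (auto simp: bump_def)
    qed
    moreover have "first_min M (\<lambda>n. f n - bump q n + 2 * bump r n) p"
      unfolding first_min_def
    proof (intro conjI allI impI)
      show "p < M" by fact
      fix n
      show "f (Suc p) - bump q (Suc p) + 2 * bump r (Suc p) < f n - bump q n + 2 * bump r n" if "n \<le> p"
        using that pq r_eq f1[of n] by (auto simp: bump_def)
      show "f (Suc p) - bump q (Suc p) + 2 * bump r (Suc p) \<le> f n - bump q n + 2 * bump r n" if "n \<le> M"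
        using that pq r_eq f2[of n] r_least[of n] by (cases "q < n"; cases "r < n") (auto simp: bump_def)
    qed
    moreover have "first_min M (\<lambda>n. k n + 2 * bump q n - bump r n - bump p n) s"
      unfolding first_min_def
    proof (intro conjI allI impI)
      show "s < M" using s_eq qM by simp
      fix n
      show "k (Suc s) + 2 * bump q (Suc s) - bump r (Suc s) - bump p (Suc s)
          < k n + 2 * bump q n - bump r n - bump p n" if "n \<le> s"
        using that s_eq r_eq k1[of n] s_least[of n] by (cases "p < n") (auto simp: bump_def)
      show "k (Suc s) + 2 * bump q (Suc s) - bump r (Suc s) - bump p (Suc s)
          \<le> k n + 2 * bump q n - bump r n - bump p n" if "n \<le> M"
        using that s_eq pq r_eq k1[of n] k2[of n]
        by (cases "p < n"; cases "q < n"; cases "r < n") (auto simp: bump_def)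
    qed
    ultimately show ?thesis by blast
  qed
qed

text \<open>The function \<open>bd\<close> collects signature entries that belong to no letter. As
  it only rises, every fall of \<open>height\<close> is caused by a letter of the right
  residue.\<close>

locale word_crystal =
  fixes e :: int and M :: nat and bd :: "int \<Rightarrow> nat \<Rightarrow> int"
  assumes e_ge: "2 \<le> e" and bd_mono: "bd i n \<le> bd i (Suc n)"
begin

definition height :: "int \<Rightarrow> (nat \<Rightarrow> int) \<Rightarrow> nat \<Rightarrow> int" where
  "height i g n = bd i n + (\<Sum>t<n. dstep e i (g t))"

definition estep :: "int \<Rightarrow> (nat \<Rightarrow> int) \<Rightarrow> (nat \<Rightarrow> int) \<Rightarrow> bool" where
  "estep i g g' \<longleftrightarrow> (\<exists>p. first_min M (height i g) p \<and> g' = dec p g)"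

lemma first_min_residue:
  assumes "first_min M (height i g) p"
  shows "g p mod e = i"
proof -
  have "height i g (Suc p) < height i g p" using assms unfolding first_min_def by auto
  then have "dstep e i (g p) < 0" using bd_mono[of i p] unfolding height_def by simp
  then show ?thesis unfolding dstep_def by (auto simp: of_bool_def split: if_splits)
qed

lemma height_dec:
  "height i (dec p g) n = height i g n + (dstep e i (g p - 1) - dstep e i (g p)) * bump p n"
proof (cases "p < n")
  case True
  have eq: "{..<n} = insert p ({..<n} - {p})" using True by auto
  have "(\<Sum>t<n. dstep e i (dec p g t)) = dstep e i (g p - 1) + (\<Sum>t\<in>{..<n} - {p}. dstep e i (dec p g t))"
    by (subst eq, subst sum.insert) (auto simp: dec_def)
  also have "(\<Sum>t\<in>{..<n} - {p}. dstep e i (dec p g t)) = (\<Sum>t\<in>{..<n} - {p}. dstep e i (g t))"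
    by (rule sum.cong) (auto simp: dec_def)
  finally have 1: "(\<Sum>t<n. dstep e i (dec p g t)) = dstep e i (g p - 1) + (\<Sum>t\<in>{..<n} - {p}. dstep e i (g t))" .
  have 2: "(\<Sum>t<n. dstep e i (g t)) = dstep e i (g p) + (\<Sum>t\<in>{..<n} - {p}. dstep e i (g t))"
    by (subst eq, subst sum.insert) auto
  show ?thesis using True 1 2 by (simp add: height_def bump_def)
next
  case False
  then have "(\<Sum>t<n. dstep e i (dec p g t)) = (\<Sum>t<n. dstep e i (g t))"
    by (intro sum.cong) (auto simp: dec_def)
  then show ?thesis using False by (simp add: height_def bump_def)
qed

lemma mod_diff_neq:
  assumes "\<not> e dvd d"
  shows "(v + d) mod e \<noteq> v mod e"
  using assms mod_eq_dvd_iff[of "v + d" e v] by auto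

lemma height_dec_same:
  assumes "g p mod e = i"
  shows "height i (dec p g) n = height i g n + 2 * bump p n"
proof -
  have "\<not> e dvd 1" "\<not> e dvd - 1" using e_ge by (auto dest: zdvd_imp_le)
  then have "(g p + 1) mod e \<noteq> i" "(g p - 1) mod e \<noteq> i"
    using mod_diff_neq[of 1 "g p"] mod_diff_neq[of "- 1" "g p"] assms by auto
  then show ?thesis using assms by (simp add: height_dec dstep_def)
qed

text \<open>The coefficient -1 relies on \<open>i - 1\<close> and \<open>i + 1\<close> being
  distinct modulo \<open>e\<close>, hence \<open>3 \<le> e\<close>; for \<open>e = 2\<close> both
  neighbours contribute and the coefficient is -2.\<close>

lemma height_dec_adjacent:
  assumes "g p mod e = i" "3 \<le> e" "0 \<le> j" "j < e" "j = (i + 1) mod e \<or> i = (j + 1) mod e"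
  shows "height j (dec p g) n = height j g n - bump p n"
proof -
  have nd: "\<not> e dvd 1" "\<not> e dvd - 1" "\<not> e dvd 2" "\<not> e dvd - 2"
    using assms(2) by (auto dest: zdvd_imp_le)
  show ?thesis using assms(5)
  proof
    assume j: "j = (i + 1) mod e"
    then have "(g p + 1) mod e = j" using assms(1) by (metis mod_add_left_eq)
    moreover from this have "g p mod e \<noteq> j" "(g p - 1) mod e \<noteq> j"
      using mod_diff_neq[OF nd(2), of "g p + 1"] mod_diff_neq[OF nd(4), of "g p + 1"] by auto
    ultimately show ?thesis by (simp add: height_dec dstep_def)
  next
    assume i: "i = (j + 1) mod e"
    have "(g p - 1) mod e = (i - 1) mod e" using assms(1) by (metis mod_diff_left_eq)
    also have "\<dots> = j" using i assms(3,4) by (simp add: mod_diff_left_eq)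
    finally have "(g p - 1) mod e = j" .
    moreover from this have "g p mod e \<noteq> j" "(g p + 1) mod e \<noteq> j"
      using mod_diff_neq[OF nd(1), of "g p - 1"] mod_diff_neq[OF nd(3), of "g p - 1"]
      by (auto simp: algebra_simps)
    ultimately show ?thesis by (simp add: height_dec dstep_def)
  qed
qed

lemma height_dec_far:
  assumes "g p mod e = i" "0 \<le> j" "j < e" "j \<noteq> i" "j \<noteq> (i + 1) mod e" "i \<noteq> (j + 1) mod e"
  shows "height j (dec p g) n = height j g n"
proof -
  have "(g p + 1) mod e \<noteq> j" using assms(1,5) by (metis mod_add_left_eq)
  moreover have "(g p - 1) mod e \<noteq> j"
  proof
    assume "(g p - 1) mod e = j"
    then have "(j + 1) mod e = g p mod e" by (metis mod_add_left_eq diff_add_cancel)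
    then show False using assms by simp
  qed
  ultimately show ?thesis using assms by (simp add: height_dec dstep_def)
qed

text \<open>The slot can be read off the target: \<open>height\<close> falls by exactly 1 at the
  removed slot \<open>p\<close>, and the removal adds 2 beyond \<open>p\<close>, so \<open>p\<close>
  is the last minimum of the new height function.\<close>

lemma estep_source_unique:
  assumes "estep i g g'" "estep i k g'"
  shows "g = k"
proof -
  obtain p where p: "first_min M (height i g) p" "g' = dec p g" using assms unfolding estep_def by auto
  obtain q where q: "first_min M (height i k) q" "g' = dec q k" using assms unfolding estep_def by auto
  have hp: "height i g' n = height i g n + 2 * bump p n" for n
    using height_dec_same[of g p i n] first_min_residue p by simp
  have hq: "height i g' n = height i k n + 2 * bump q n" for n
    using height_dec_same[of k q i n] first_min_residue q by simp
  have last: "height i g' a \<le> height i g' n \<and> (a < n \<longrightarrow> height i g' a < height i g' n)"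
    if "first_min M (height i f) a" "\<And>n. height i g' n = height i f n + 2 * bump a n" "n \<le> M"
      "g' = dec a f" for a f n
  proof -
    have "height i f a = height i f (Suc a) + 1"
    proof -
      have "dstep e i (f a) \<ge> -1" by (simp add: dstep_def)
      then show ?thesis using that(1) bd_mono[of i a] unfolding first_min_def height_def
        by (auto dest!: spec[of _ a])
    qed
    then show ?thesis using that(1,3) unfolding that(2) first_min_def bump_def
      by (cases "n \<le> a"; fastforce)
  qed
  have "p \<le> M" "q \<le> M" using p q unfolding first_min_def by auto
  then have "p = q"
    using last[OF p(1) hp \<open>q \<le> M\<close> p(2)] last[OF q(1) hq \<open>p \<le> M\<close> q(2)]
    by (metis linorder_neqE_nat not_le)
  moreover have "f = (dec a f)(a := dec a f a + 1)" for f a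
    by (simp add: dec_def)
  ultimately show ?thesis using p(2) q(2) by metis
qed


definition estep_any :: "(nat \<Rightarrow> int) \<Rightarrow> (nat \<Rightarrow> int) \<Rightarrow> bool" where
  "estep_any g g' \<longleftrightarrow> (\<exists>i. estep i g g')"

lemma estepI: "first_min M (height i g) p \<Longrightarrow> estep i g (dec p g)"
  unfolding estep_def by blast

lemma estep_any3:
  assumes "estep i a b" "estep j b c" "estep k c d"
  shows "estep_any\<^sup>*\<^sup>* a d"
proof -
  have "estep_any a b" "estep_any b c" "estep_any c d" using assms unfolding estep_any_def by auto
  then show ?thesis by (meson converse_rtranclp_into_rtranclp r_into_rtranclp)
qed

text \<open>Either the two removals commute, or both branches close up with residue patterns
  \<open>i j j i\<close> and \<open>j i i j\<close>. In the second case both remove the same four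
  slots \<open>p\<close>, \<open>q\<close>, \<open>r\<close>, \<open>s\<close>, in different
  order.\<close>

lemma estep_confluent_adjacent:
  assumes fp: "first_min M (height i g) p" and fq: "first_min M (height j g) q" and pq: "p < q"
    and e3: "3 \<le> e" and adj: "j = (i + 1) mod e \<or> i = (j + 1) mod e"
  shows "\<exists>g'. estep_any\<^sup>*\<^sup>* (dec p g) g' \<and> estep_any\<^sup>*\<^sup>* (dec q g) g'"
proof -
  have ri: "g p mod e = i" and rj: "g q mod e = j" using fp fq first_min_residue by auto
  have range: "0 \<le> i" "i < e" "0 \<le> j" "j < e" using ri rj e_ge by auto
  have drop: "height j g q = height j g (Suc q) + 1"
  proof -
    have "dstep e j (g q) \<ge> -1" by (simp add: dstep_def)
    then show ?thesis using fq bd_mono[of j q] unfolding first_min_def height_def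
      by (auto dest!: spec[of _ q])
  qed
  have ii: "height i (dec t w) = (\<lambda>n. height i w n + 2 * bump t n)"
    and ij: "height j (dec t w) = (\<lambda>n. height j w n - bump t n)"
    if "first_min M (height i w) t" for t w
    using height_dec_same height_dec_adjacent[of w t i j] first_min_residue[OF that] e3 adj range by auto
  have jj: "height j (dec t w) = (\<lambda>n. height j w n + 2 * bump t n)"
    and ji: "height i (dec t w) = (\<lambda>n. height i w n - bump t n)"
    if "first_min M (height j w) t" for t w
    using height_dec_same height_dec_adjacent[of w t j i] first_min_residue[OF that] e3 adj range by auto
  note conf = first_min_confluent[OF fp fq pq drop]
  have pq': "first_min M (height j (dec p g)) q" using conf(1) by (simp add: ij[OF fp])
  from conf(2) show ?thesis
  proof
    assume "first_min M (\<lambda>n. height i g n - bump q n) p"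
    then have "first_min M (height i (dec q g)) p" by (simp add: ji[OF fq])
    then have "estep i (dec q g) (dec p (dec q g))" by (rule estepI)
    moreover have "estep j (dec p g) (dec p (dec q g))" using estepI[OF pq'] by (simp add: dec_commute)
    ultimately show ?thesis unfolding estep_any_def by blast
  next
    assume "\<exists>r s. first_min M (\<lambda>n. height j g n - bump p n + 2 * bump q n) s \<and>
       first_min M (\<lambda>n. height i g n + 2 * bump p n - bump q n - bump s n) r \<and>
       first_min M (\<lambda>n. height i g n - bump q n) r \<and>
       first_min M (\<lambda>n. height i g n - bump q n + 2 * bump r n) p \<and>
       first_min M (\<lambda>n. height j g n + 2 * bump q n - bump r n - bump p n) s"
    then obtain r s where
      a1: "first_min M (\<lambda>n. height j g n - bump p n + 2 * bump q n) s" and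
      a2: "first_min M (\<lambda>n. height i g n + 2 * bump p n - bump q n - bump s n) r" and
      b1: "first_min M (\<lambda>n. height i g n - bump q n) r" and
      b2: "first_min M (\<lambda>n. height i g n - bump q n + 2 * bump r n) p" and
      b3: "first_min M (\<lambda>n. height j g n + 2 * bump q n - bump r n - bump p n) s" by blast
    have A1: "first_min M (height j (dec q (dec p g))) s"
      using a1 by (simp add: jj[OF pq'] ij[OF fp])
    have A2: "first_min M (height i (dec s (dec q (dec p g)))) r"
      using a2 by (simp add: ji[OF A1] ji[OF pq'] ii[OF fp])
    have B1: "first_min M (height i (dec q g)) r" using b1 by (simp add: ji[OF fq])
    have B2: "first_min M (height i (dec r (dec q g))) p" using b2 by (simp add: ii[OF B1] ji[OF fq])
    have B3: "first_min M (height j (dec p (dec r (dec q g)))) s"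
      using b3 by (simp add: ij[OF B2] ij[OF B1] jj[OF fq])
    have "estep_any\<^sup>*\<^sup>* (dec p g) (dec r (dec s (dec q (dec p g))))"
      by (rule estep_any3[OF estepI[OF pq'] estepI[OF A1] estepI[OF A2]])
    moreover have "estep_any\<^sup>*\<^sup>* (dec q g) (dec s (dec p (dec r (dec q g))))"
      by (rule estep_any3[OF estepI[OF B1] estepI[OF B2] estepI[OF B3]])
    moreover have "dec s (dec p (dec r (dec q g))) = dec r (dec s (dec q (dec p g)))"
      by (metis dec_commute)
    ultimately show ?thesis by metis
  qed
qed

lemma estep_confluent:
  assumes e3: "3 \<le> e" and "estep i g g1" "estep j g g2"
  shows "\<exists>g'. estep_any\<^sup>*\<^sup>* g1 g' \<and> estep_any\<^sup>*\<^sup>* g2 g'"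
proof -
  obtain p where p: "first_min M (height i g) p" "g1 = dec p g" using assms unfolding estep_def by auto
  obtain q where q: "first_min M (height j g) q" "g2 = dec q g" using assms unfolding estep_def by auto
  have ri: "g p mod e = i" and rj: "g q mod e = j" using p q first_min_residue by auto
  have range: "0 \<le> i" "i < e" "0 \<le> j" "j < e" using ri rj e_ge by auto
  consider "i = j" | "j = (i + 1) mod e \<or> i = (j + 1) mod e"
    | "i \<noteq> j" "j \<noteq> (i + 1) mod e" "i \<noteq> (j + 1) mod e" by blast
  then show ?thesis
  proof cases
    case 1
    then have "g1 = g2" using p q first_min_unique by blast
    then show ?thesis by blast
  next
    case 2
    have "p \<noteq> q"
    proof
      assume "p = q"
      then have "i = j" using ri rj by simp
      then have "(i + 1) mod e = i mod e" using 2 range by auto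
      moreover have "\<not> e dvd 1" using e_ge by (auto dest: zdvd_imp_le)
      ultimately show False using mod_diff_neq by blast
    qed
    then consider "p < q" | "q < p" by linarith
    then show ?thesis
    proof cases
      case 1
      then show ?thesis using estep_confluent_adjacent[OF p(1) q(1) _ e3 2] p q by blast
    next
      case 2
      then show ?thesis
        using estep_confluent_adjacent[OF q(1) p(1) _ e3] \<open>j = (i + 1) mod e \<or> i = (j + 1) mod e\<close> p q
        by blast
    qed
  next
    case 3
    have "height j (dec p g) = height j g"
      using height_dec_far[where g = g, OF ri range(3,4)] 3 by auto
    then have "estep j g1 (dec q g1)" using q p by (metis estepI)
    moreover have "height i (dec q g) = height i g"
      using height_dec_far[where g = g, OF rj range(1,2)] 3 by auto
    then have "estep i g2 (dec p g2)" using q p by (metis estepI)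
    moreover have "dec q g1 = dec p g2" using p q dec_commute by simp
    ultimately show ?thesis unfolding estep_any_def by (metis (mono_tags, lifting) r_into_rtranclp)
  qed
qed

end


section \<open>Bipartitions as words\<close>

definition walk :: "(nat \<Rightarrow> bool) \<Rightarrow> (nat \<Rightarrow> bool) \<Rightarrow> nat \<Rightarrow> int" where
  "walk a r n = (\<Sum>t<n. of_bool (a t) - of_bool (r t))"

lemma walk_Suc: "walk a r (Suc n) = walk a r n + of_bool (a n) - of_bool (r n)"
  by (simp add: walk_def)

lemma walk_between:
  assumes "s < p"
  shows "walk a r p - walk a r (Suc s) =
    int (card {t. s < t \<and> t < p \<and> a t}) - int (card {t. s < t \<and> t < p \<and> r t})"
proof -
  have card: "int (card {t. s < t \<and> t < p \<and> P t}) = (\<Sum>t\<in>{Suc s..<p}. of_bool (P t))" for P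
  proof -
    have "{t. s < t \<and> t < p \<and> P t} = {t\<in>{Suc s..<p}. P t}" by auto
    then show ?thesis by (simp add: sum.inter_filter[symmetric] of_bool_def)
  qed
  have "{..<p} = {..<Suc s} \<union> {Suc s..<p}" using assms by auto
  then have "walk a r p = walk a r (Suc s) + (\<Sum>t\<in>{Suc s..<p}. of_bool (a t) - of_bool (r t))"
    unfolding walk_def by (simp add: sum.union_disjoint ivl_disj_int del: sum.lessThan_Suc)
  then show ?thesis by (simp only: card sum_subtractf)
qed

definition normal_slot :: "(nat \<Rightarrow> bool) \<Rightarrow> (nat \<Rightarrow> bool) \<Rightarrow> nat \<Rightarrow> bool" where
  "normal_slot a r p \<longleftrightarrow> r p \<and> (\<forall>s<p. a s \<longrightarrow>
     card {t. s < t \<and> t < p \<and> r t} > card {t. s < t \<and> t < p \<and> a t})"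

text \<open>Normal slots are the strict record lows of the walk. The count condition at an addable
  slot \<open>s\<close> says that the walk at \<open>p\<close> lies below its value just after
  \<open>s\<close>, that is, not above its value at \<open>s\<close>.\<close>

lemma normal_slot_iff:
  assumes dis: "\<And>t. \<not> (a t \<and> r t)"
  shows "normal_slot a r p \<longleftrightarrow> r p \<and> (\<forall>n\<le>p. walk a r (Suc p) < walk a r n)"
proof (intro iffI conjI allI impI)
  assume nrm: "normal_slot a r p"
  then show "r p" by (simp add: normal_slot_def)
  then have Sp: "walk a r (Suc p) = walk a r p - 1" using dis by (auto simp: walk_Suc)
  \<comment> \<open>Downward induction on \<open>n\<close>: only an addable slot raises the walk,
    and there normality itself supplies the bound.\<close>
  have "walk a r p \<le> walk a r n" if "n \<le> p" for n
    using that
  proof (induction "p - n" arbitrary: n)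
    case (Suc d)
    then have np: "n < p" and IH: "walk a r p \<le> walk a r (Suc n)" by auto
    show ?case
    proof (cases "a n")
      case True
      then have "walk a r p < walk a r (Suc n)"
        using nrm np walk_between[OF np, of a r] unfolding normal_slot_def by force
      then show ?thesis by (auto simp: walk_Suc of_bool_def split: if_splits)
    qed (use IH in \<open>auto simp: walk_Suc of_bool_def split: if_splits\<close>)
  qed simp
  then show "walk a r (Suc p) < walk a r n" if "n \<le> p" for n using that Sp by force
next
  assume H: "r p \<and> (\<forall>n\<le>p. walk a r (Suc p) < walk a r n)"
  then have Sp: "walk a r (Suc p) = walk a r p - 1" using dis by (auto simp: walk_Suc)
  show "normal_slot a r p"
    unfolding normal_slot_def
  proof (intro conjI allI impI)
    show "r p" using H by simp
    fix s assume s: "s < p" "a s"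
    have "walk a r (Suc p) < walk a r s" using H s(1) less_imp_le by blast
    then have "walk a r p \<le> walk a r s" using Sp by simp
    then have "walk a r p < walk a r (Suc s)" using s dis by (auto simp: walk_Suc)
    then show "card {t. s < t \<and> t < p \<and> r t} > card {t. s < t \<and> t < p \<and> a t}"
      using walk_between[OF s(1), of a r] by linarith
  qed
qed

text \<open>The last record low of a walk is its first visit to the global minimum. Slots grow from
  lower to higher rows, so the good node is the normal one in the largest slot.\<close>

lemma good_slot_iff:
  assumes dis: "\<And>t. \<not> (a t \<and> r t)" and bound: "\<And>t. r t \<Longrightarrow> t < M"
  shows "normal_slot a r p \<and> (\<forall>z. normal_slot a r z \<longrightarrow> z \<le> p) \<longleftrightarrow> first_min M (walk a r) p"
proof -
  define T where "T = walk a r"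
  have nrm: "normal_slot a r z \<longleftrightarrow> r z \<and> (\<forall>n\<le>z. T (Suc z) < T n)" for z
    unfolding T_def by (rule normal_slot_iff) (rule dis)
  have drop: "r z" if "T (Suc z) < T z" for z
    using that unfolding T_def by (auto simp: walk_Suc of_bool_def split: if_splits)
  have "first_min M T p" if p: "normal_slot a r p" and hi: "\<And>z. normal_slot a r z \<Longrightarrow> z \<le> p"
  proof -
    have p2: "T (Suc p) < T n" if "n \<le> p" for n using p that unfolding nrm by blast
    have "T (Suc p) \<le> T n" for n
    proof (rule ccontr)
      assume n: "\<not> ?thesis"
      \<comment> \<open>The first position below \<open>T (Suc p)\<close> would be entered by a
        further record low beyond \<open>p\<close>, against the maximality of
        \<open>p\<close>.\<close>
      define m where "m = (LEAST m. T m < T (Suc p))"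
      have m: "T m < T (Suc p)" unfolding m_def by (rule LeastI[of _ n]) (use n in simp)
      have m_least: "T (Suc p) \<le> T j" if "j < m" for j
        using not_less_Least[of j "\<lambda>m. T m < T (Suc p)"] that unfolding m_def by simp
      have pm: "p < m" using p2[of m] m by linarith
      then obtain z where z: "m = Suc z" by (cases m) auto
      have "T (Suc z) < T j" if "j \<le> z" for j using m m_least[of j] z that by simp
      then have "normal_slot a r z" unfolding nrm using drop by blast
      then have "z = p" using hi pm z by fastforce
      then show False using m z by simp
    qed
    moreover have "p < M" using p bound unfolding nrm by blast
    ultimately show ?thesis using p2 unfolding first_min_def by blast
  qed
  moreover have "normal_slot a r p \<and> (\<forall>z. normal_slot a r z \<longrightarrow> z \<le> p)" if R: "first_min M T p"
  proof (intro conjI allI impI)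
    have p2: "T (Suc p) < T n" if "n \<le> p" for n using R that unfolding first_min_def by blast
    then show "normal_slot a r p" unfolding nrm using drop by blast
    fix z assume z: "normal_slot a r z"
    show "z \<le> p"
    proof (rule ccontr)
      assume "\<not> z \<le> p"
      then have "T (Suc z) < T (Suc p)" "Suc z \<le> M"
        using z bound unfolding nrm by (auto simp: Suc_le_eq)
      then show False using R unfolding first_min_def by (meson leD)
    qed
  qed
  ultimately show ?thesis unfolding T_def by blast
qed

section \<open>Diagrams encoded by row lengths\<close>

lemma down_closed_interval:
  fixes S :: "nat set"
  assumes "finite S" "\<And>c. c \<in> S \<Longrightarrow> 1 \<le> c" "\<And>c c'. c \<in> S \<Longrightarrow> 1 \<le> c' \<Longrightarrow> c' \<le> c \<Longrightarrow> c' \<in> S"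
  shows "S = {1..card S}"
proof (cases "S = {}")
  case False
  then have "Max S \<in> S" "\<And>c. c \<in> S \<Longrightarrow> c \<le> Max S" using assms(1) by auto
  moreover have "c \<in> S" if "1 \<le> c" "c \<le> Max S" for c
    using assms(3)[OF \<open>Max S \<in> S\<close> that] .
  ultimately have "\<exists>m. S = {1..m}" using assms(2) by (intro exI[of _ "Max S"] set_eqI) (meson atLeastAtMost_iff)
  then obtain m where S: "S = {1..m}" ..
  show ?thesis unfolding S by simp
qed simp

lemma is_bipartition_closed:
  assumes "is_bipartition Y" "(r, c, k) \<in> Y" "1 \<le> r'" "r' \<le> r" "1 \<le> c'" "c' \<le> c"
  shows "(r', c', k) \<in> Y"
  using assms unfolding is_bipartition_def by blast

locale abacus =
  fixes l N :: nat
  assumes l_pos: "1 \<le> l" and N_pos: "1 \<le> N"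
begin

text \<open>The rows up to \<open>N\<close> of a bipartition are numbered from the lowest to the highest with respect to
  \<open>below\<close>: the slots \<open>0, \<dots>, N - 1\<close> are the rows \<open>N, \<dots>, 1\<close> of the second component, the slots
  \<open>N, \<dots>, 2 * N - 1\<close> those of the first.\<close>

definition nd :: "nat \<Rightarrow> nat \<Rightarrow> node" where
  "nd p c = (if p < N then (N - p, c, 2) else (2 * N - p, c, 1))"

definition content :: "nat \<Rightarrow> int" where
  "content p = (if p < N then int p - int N + int l else int p - 2 * int N)"

definition len :: "node set \<Rightarrow> nat \<Rightarrow> nat" where
  "len Y p = card {c. nd p c \<in> Y}"

definition diagram :: "(nat \<Rightarrow> nat) \<Rightarrow> node set" where
  "diagram L = {nd p c |p c. p < 2 * N \<and> 1 \<le> c \<and> c \<le> L p}"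

definition shape :: "(nat \<Rightarrow> nat) \<Rightarrow> bool" where
  "shape L \<longleftrightarrow> (\<forall>p. Suc p < 2 * N \<longrightarrow> Suc p \<noteq> N \<longrightarrow> L p \<le> L (Suc p))"

text \<open>The bound \<open>r < N\<close> is strict so that row \<open>N\<close> of each component
  is empty: slots \<open>0\<close> and \<open>N\<close> have length 0, and every addable node still
  lies in one of the \<open>2 * N\<close> slots.\<close>

definition bip :: "node set \<Rightarrow> bool" where
  "bip Y \<longleftrightarrow> is_bipartition Y \<and> (\<forall>(r,c,k)\<in>Y. r < N)"

text \<open>The unreduced residue of the last node of the row; up to a shift in each component these
  are the beta-numbers of the partition.\<close>

definition word :: "node set \<Rightarrow> nat \<Rightarrow> int" where
  "word Y p = int (len Y p) + content p"

lemma nd_inject: "p < 2 * N \<Longrightarrow> q < 2 * N \<Longrightarrow> nd p c = nd q c' \<longleftrightarrow> p = q \<and> c = c'"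
  by (auto simp: nd_def split: if_splits)

lemma nd_inject_col: "nd p c = nd p c' \<longleftrightarrow> c = c'"
  by (auto simp: nd_def)

lemma below_nd: "p < 2 * N \<Longrightarrow> q < 2 * N \<Longrightarrow> below (nd p c) (nd q c') \<longleftrightarrow> p < q"
  by (auto simp: nd_def below_def)

lemma res_nd: "p < 2 * N \<Longrightarrow> res l (nd p c) = (int c + content p) mod (2 * int l)"
  by (auto simp: nd_def res_def content_def of_nat_diff algebra_simps)

lemma nd_cases:
  assumes "1 \<le> r" "r \<le> N" "k = 1 \<or> k = 2"
  obtains p where "p < 2 * N" "\<And>c. (r, c, k) = nd p c"
proof
  show "(if k = 1 then 2 * N - r else N - r) < 2 * N" using assms by auto
  show "(r, c, k) = nd (if k = 1 then 2 * N - r else N - r) c" for c using assms by (auto simp: nd_def)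
qed

lemma mem_diagram: "p < 2 * N \<Longrightarrow> nd p c \<in> diagram L \<longleftrightarrow> 1 \<le> c \<and> c \<le> L p"
  by (auto simp: diagram_def nd_inject)

lemma finite_diagram: "finite (diagram L)"
proof -
  have "diagram L \<subseteq> (\<Union>p\<in>{..<2 * N}. nd p ` {1..L p})"
    unfolding diagram_def by fastforce
  then show ?thesis by (rule finite_subset) simp
qed

lemma diagram_slot_le:
  assumes "shape L" "q \<le> p'" "p' < 2 * N" "N \<le> q \<or> p' < N"
  shows "L q \<le> L p'"
  using assms(2-4)
proof (induction p' rule: dec_induct)
  case (step n)
  then have "L n \<le> L (Suc n)" using assms(1) unfolding shape_def by auto
  then show ?case using step by auto
qed simp

lemma is_bipartition_diagram: "is_bipartition (diagram L) \<longleftrightarrow> shape L"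
proof
  assume bp: "is_bipartition (diagram L)"
  show "shape L"
    unfolding shape_def
  proof (intro allI impI)
    fix p assume p: "Suc p < 2 * N" "Suc p \<noteq> N"
    show "L p \<le> L (Suc p)"
    proof (cases "L p = 0")
      case False
      then have "nd p (L p) \<in> diagram L" using p by (simp add: mem_diagram)
      moreover obtain r k where rk: "\<And>c. nd p c = (Suc r, c, k)" "\<And>c. nd (Suc p) c = (r, c, k)" "1 \<le> r"
      proof (cases "p < N")
        case True
        then show ?thesis using p that[of "N - Suc p" 2] by (auto simp: nd_def)
      next
        case False
        then show ?thesis using p that[of "2 * N - Suc p" 1] by (auto simp: nd_def)
      qed
      ultimately have "(Suc r, L p, k) \<in> diagram L" by simp
      then have "(r, L p, k) \<in> diagram L"
        by (rule is_bipartition_closed[OF bp]) (use False rk in auto)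
      then have "nd (Suc p) (L p) \<in> diagram L" by (simp add: rk)
      then show ?thesis using p by (simp add: mem_diagram)
    qed simp
  qed
next
  assume sh: "shape L"
  have "(r', c', k) \<in> diagram L"
    if m: "(r, c, k) \<in> diagram L" and that: "1 \<le> r'" "r' \<le> r" "1 \<le> c'" "c' \<le> c" for r c k r' c'
  proof -
    obtain p c0 where "p < 2 * N" "(r, c, k) = nd p c0" "c0 \<le> L p"
      using m unfolding diagram_def by blast
    moreover from this have "c0 = c" by (auto simp: nd_def split: if_splits)
    ultimately have p: "p < 2 * N" "(r, c, k) = nd p c" "c \<le> L p" by auto
    define p' where "p' = p + (r - r')"
    have "(r', c', k) = nd p' c' \<and> p' < 2 * N \<and> (N \<le> p \<or> p' < N)"
    proof (cases "p < N")
      case True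
      then have "r = N - p" "k = 2" using p(2) by (auto simp: nd_def)
      then show ?thesis using that(1,2) True by (auto simp: nd_def p'_def)
    next
      case False
      then have "r = 2 * N - p" "k = 1" using p(2) by (auto simp: nd_def)
      then show ?thesis using that(1,2) False p(1) by (auto simp: nd_def p'_def)
    qed
    moreover have "L p \<le> L p'" using diagram_slot_le[OF sh] calculation by (simp add: p'_def)
    ultimately show ?thesis using that p by (simp add: mem_diagram)
  qed
  moreover have "1 \<le> r \<and> 1 \<le> c \<and> (k = 1 \<or> k = 2)" if "(r, c, k) \<in> diagram L" for r c k
    using that by (auto simp: diagram_def nd_def split: if_splits)
  ultimately show "is_bipartition (diagram L)"
    unfolding is_bipartition_def using finite_diagram by blast
qed

lemma len_diagram: "p < 2 * N \<Longrightarrow> len (diagram L) p = L p"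
proof -
  assume "p < 2 * N"
  then have "{c. nd p c \<in> diagram L} = {1..L p}" by (auto simp: mem_diagram)
  then show ?thesis by (simp add: len_def)
qed

lemma mem_bip:
  assumes "bip Y"
  shows "nd p c \<in> Y \<longleftrightarrow> 1 \<le> c \<and> c \<le> len Y p"
proof -
  define S where "S = {c. nd p c \<in> Y}"
  have "nd p ` S \<subseteq> Y" by (auto simp: S_def)
  moreover have "finite Y" using assms by (simp add: bip_def is_bipartition_def)
  moreover have "inj_on (nd p) S" by (simp add: inj_on_def nd_inject_col)
  ultimately have "finite S" using inj_on_finite by blast
  moreover have "1 \<le> c" if "c \<in> S" for c
    using that assms unfolding S_def bip_def is_bipartition_def nd_def by (auto split: if_splits)
  moreover have "c' \<in> S" if "c \<in> S" "1 \<le> c'" "c' \<le> c" for c c'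
  proof -
    obtain r k where rk: "\<And>c. nd p c = (r, c, k)" unfolding nd_def by (cases "p < N") auto
    have "(r, c, k) \<in> Y" using that rk by (simp add: S_def)
    then have "(r, c', k) \<in> Y"
    proof (rule is_bipartition_closed[rotated])
      show "is_bipartition Y" using assms by (simp add: bip_def)
      then show "1 \<le> r" using \<open>(r, c, k) \<in> Y\<close> unfolding is_bipartition_def by auto
    qed (use that in auto)
    then show ?thesis by (simp add: S_def rk)
  qed
  ultimately have "S = {1..len Y p}" unfolding len_def S_def[symmetric] by (rule down_closed_interval)
  then show ?thesis by (auto simp: S_def)
qed

lemma bip_diagram:
  assumes "bip Y"
  shows "Y = diagram (len Y)" "shape (len Y)" "len Y 0 = 0" "len Y N = 0"
proof -
  show Y: "Y = diagram (len Y)"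
  proof (rule set_eqI)
    fix x :: node
    obtain r c k where x: "x = (r, c, k)" by (cases x)
    show "x \<in> Y \<longleftrightarrow> x \<in> diagram (len Y)"
    proof
      assume xY: "x \<in> Y"
      then have "1 \<le> r" "r \<le> N" "k = 1 \<or> k = 2"
        using assms x unfolding bip_def is_bipartition_def by force+
      then obtain p where "p < 2 * N" "x = nd p c" using nd_cases x by metis
      then show "x \<in> diagram (len Y)" using xY mem_bip[OF assms] mem_diagram by simp
    next
      assume "x \<in> diagram (len Y)"
      then show "x \<in> Y" using mem_bip[OF assms] unfolding diagram_def by auto
    qed
  qed
  show "shape (len Y)" using assms Y is_bipartition_diagram unfolding bip_def by metis
  have "nd 0 c \<notin> Y" "nd N c \<notin> Y" for c
    using assms N_pos unfolding bip_def nd_def by auto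
  then show "len Y 0 = 0" "len Y N = 0" by (simp_all add: len_def)
qed

lemma mem_bipE:
  assumes "bip Y" "x \<in> Y"
  obtains p c where "p < 2 * N" "x = nd p c" "1 \<le> c" "c \<le> len Y p"
proof -
  have "x \<in> diagram (len Y)" using assms(2) bip_diagram(1)[OF assms(1)] by blast
  then show ?thesis using that unfolding diagram_def by blast
qed

lemma bip_eqI:
  assumes "bip Y" "bip Z" "\<And>p. p < 2 * N \<Longrightarrow> len Y p = len Z p"
  shows "Y = Z"
proof -
  have "diagram (len Y) = diagram (len Z)" unfolding diagram_def using assms(3) by metis
  then show ?thesis using bip_diagram(1) assms by metis
qed

text \<open>The first row of a component, where no row above limits the length.\<close>

definition top_slot :: "nat \<Rightarrow> bool" where
  "top_slot p \<longleftrightarrow> Suc p = N \<or> Suc p = 2 * N"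

lemma insert_diagram:
  assumes "p < 2 * N"
  shows "insert (nd p (Suc (L p))) (diagram L) = diagram (L(p := Suc (L p)))"
  using assms by (auto simp: diagram_def le_Suc_eq)

lemma delete_diagram:
  assumes "p < 2 * N"
  shows "diagram L - {nd p (L p)} = diagram (L(p := L p - 1))"
proof -
  have "x \<in> diagram L - {nd p (L p)} \<longleftrightarrow> x \<in> diagram (L(p := L p - 1))"
    if "x = nd q c" "q < 2 * N" for x q c
    using that assms by (auto simp: mem_diagram nd_inject)
  then show ?thesis unfolding diagram_def by blast
qed

lemma addable_iff:
  assumes "bip Y"
  shows "addable Y y \<longleftrightarrow> (\<exists>p<2 * N. y = nd p (Suc (len Y p)) \<and> (top_slot p \<or> len Y p < len Y (Suc p)))"
proof -
  have shp: "shape ((len Y)(p := Suc (len Y p))) \<longleftrightarrow> top_slot p \<or> len Y p < len Y (Suc p)"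
    if "p < 2 * N" for p
    using bip_diagram(2)[OF assms] that unfolding shape_def top_slot_def
    by (auto simp: le_Suc_eq Suc_le_eq)
  have ins: "is_bipartition (insert (nd p (Suc (len Y p))) Y) \<longleftrightarrow> top_slot p \<or> len Y p < len Y (Suc p)"
    if "p < 2 * N" for p
    using insert_diagram[OF that, of "len Y"] bip_diagram(1)[OF assms] is_bipartition_diagram shp[OF that] by metis
  show ?thesis
  proof
    assume ad: "addable Y y"
    obtain r c k where y: "y = (r, c, k)" by (cases y)
    have yY: "y \<notin> Y" and bp: "is_bipartition (insert y Y)" using ad by (auto simp: addable_def)
    have dom: "1 \<le> r" "1 \<le> c" "k = 1 \<or> k = 2" using bp y unfolding is_bipartition_def by auto
    have closed: "(r', c', k) \<in> insert y Y" if "1 \<le> r'" "r' \<le> r" "1 \<le> c'" "c' \<le> c" for r' c'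
      using bp y that unfolding is_bipartition_def by blast
    have "r \<le> N"
    proof (cases "r = 1")
      case False
      then have "(r - 1, c, k) \<in> insert y Y" using dom by (intro closed) auto
      then have "(r - 1, c, k) \<in> Y" using dom y by auto
      then show ?thesis using assms unfolding bip_def by auto
    qed (use N_pos in simp)
    then obtain p where p: "p < 2 * N" "\<And>c. (r, c, k) = nd p c" using nd_cases dom by metis
    have "c = Suc (len Y p)"
    proof -
      have "len Y p < c" using yY y p dom mem_bip[OF assms] by (metis not_le)
      moreover have "c - 1 \<le> len Y p" if "c \<noteq> 1"
      proof -
        have "(r, c - 1, k) \<in> insert y Y" using dom that by (intro closed) auto
        moreover have "(r, c - 1, k) \<noteq> y" using dom y by auto
        ultimately show ?thesis using p(2) mem_bip[OF assms] by simp
      qed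
      ultimately show ?thesis by (cases "c = 1") auto
    qed
    then show "\<exists>p<2 * N. y = nd p (Suc (len Y p)) \<and> (top_slot p \<or> len Y p < len Y (Suc p))"
      using ins[OF p(1)] p y bp by metis
  next
    assume "\<exists>p<2 * N. y = nd p (Suc (len Y p)) \<and> (top_slot p \<or> len Y p < len Y (Suc p))"
    then show "addable Y y" using ins mem_bip[OF assms] unfolding addable_def by auto
  qed
qed

text \<open>Slots \<open>0\<close> and \<open>N\<close> are empty, so \<open>0 < len Y p\<close>
  guarantees that slot \<open>p - 1\<close> exists and belongs to the same component.\<close>

lemma removable_iff:
  assumes "bip Y"
  shows "removable Y x \<longleftrightarrow>
    (\<exists>p<2 * N. x = nd p (len Y p) \<and> 0 < len Y p \<and> len Y (p - 1) < len Y p)"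
proof -
  have shp: "shape ((len Y)(p := len Y p - 1)) \<longleftrightarrow> len Y (p - 1) < len Y p"
    if "p < 2 * N" "0 < len Y p" for p
  proof -
    have "p \<noteq> 0" "p \<noteq> N" using that bip_diagram(3,4)[OF assms] by (metis less_irrefl)+
    then obtain q where q: "p = Suc q" "Suc q \<noteq> N" using not0_implies_Suc by blast
    have sh: "shape (len Y)" by (rule bip_diagram(2)[OF assms])
    show ?thesis
    proof
      assume "shape ((len Y)(p := len Y p - 1))"
      then have "((len Y)(p := len Y p - 1)) q \<le> ((len Y)(p := len Y p - 1)) (Suc q)"
        using that q unfolding shape_def by blast
      then show "len Y (p - 1) < len Y p" using q that by simp
    next
      assume lt: "len Y (p - 1) < len Y p"
      show "shape ((len Y)(p := len Y p - 1))"
        unfolding shape_def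
      proof (intro allI impI)
        fix t assume t: "Suc t < 2 * N" "Suc t \<noteq> N"
        then have "len Y t \<le> len Y (Suc t)" using sh unfolding shape_def by blast
        then show "((len Y)(p := len Y p - 1)) t \<le> ((len Y)(p := len Y p - 1)) (Suc t)"
          using lt by (auto simp: le_diff_conv)
      qed
    qed
  qed
  have del: "is_bipartition (Y - {nd p (len Y p)}) \<longleftrightarrow> len Y (p - 1) < len Y p"
    if "p < 2 * N" "0 < len Y p" for p
    using delete_diagram[OF that(1), of "len Y"] bip_diagram(1)[OF assms] is_bipartition_diagram shp[OF that]
    by metis
  show ?thesis
  proof
    assume rm: "removable Y x"
    then have xY: "x \<in> Y" and bp: "is_bipartition (Y - {x})" by (auto simp: removable_def)
    obtain p c where p: "p < 2 * N" "x = nd p c" "1 \<le> c" "c \<le> len Y p"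
      using mem_bipE[OF assms xY] .
    have "c = len Y p"
    proof (rule ccontr)
      assume "c \<noteq> len Y p"
      then have "nd p (len Y p) \<in> Y - {x}" using p mem_bip[OF assms] by (auto simp: nd_inject_col)
      moreover obtain r k where rk: "\<And>c. nd p c = (r, c, k)" unfolding nd_def by (cases "p < N") auto
      moreover have "1 \<le> r" using p(1) rk[of 0] by (auto simp: nd_def split: if_splits)
      ultimately have "(r, c, k) \<in> Y - {x}"
        using is_bipartition_closed[OF bp, of r "len Y p" k r c] p by simp
      then show False using p rk by simp
    qed
    then show "\<exists>p<2 * N. x = nd p (len Y p) \<and> 0 < len Y p \<and> len Y (p - 1) < len Y p"
      using p bp del by (metis less_le_trans zero_less_one)
  next
    assume "\<exists>p<2 * N. x = nd p (len Y p) \<and> 0 < len Y p \<and> len Y (p - 1) < len Y p"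
    then show "removable Y x" using del mem_bip[OF assms] unfolding removable_def by (auto simp: Suc_le_eq)
  qed
qed

lemma len_delete:
  assumes "bip Y" "p < 2 * N" "q < 2 * N"
  shows "len (Y - {nd p (len Y p)}) q = ((len Y)(p := len Y p - 1)) q"
  using delete_diagram[OF assms(2), of "len Y"] bip_diagram(1)[OF assms(1)] len_diagram[OF assms(3)] by metis

lemma removableE:
  assumes "bip Y" "removable Y x"
  obtains p where "p < 2 * N" "x = nd p (len Y p)" "0 < len Y p" "len Y (p - 1) < len Y p"
    "bip (Y - {x})" "word (Y - {x}) = dec p (word Y)"
proof -
  obtain p where p: "p < 2 * N" "x = nd p (len Y p)" "0 < len Y p" "len Y (p - 1) < len Y p"
    using assms removable_iff by blast
  have b: "bip (Y - {x})" using assms unfolding bip_def removable_def by auto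
  have "len (Y - {x}) q = len Y q - of_bool (q = p)" for q
  proof (cases "q < 2 * N")
    case True
    then show ?thesis using len_delete[OF assms(1) p(1) True] p by auto
  next
    case False
    then have "nd q c \<noteq> x" for c using p by (auto simp: nd_def split: if_splits)
    then show ?thesis using p False by (auto simp: len_def)
  qed
  then have "word (Y - {x}) = dec p (word Y)"
    using p(3) by (auto simp: word_def dec_def fun_eq_iff of_nat_diff)
  then show ?thesis using that p b by blast
qed

lemma word_inject:
  assumes "bip Y" "bip Z" "word Y = word Z"
  shows "Y = Z"
  by (rule bip_eqI[OF assms(1,2)]) (use assms(3) in \<open>auto simp: word_def fun_eq_iff\<close>)

section \<open>Signatures read off the word\<close>

abbreviation "e \<equiv> 2 * int l"

text \<open>The contributions to the signature of the rows \<open>N + 1\<close> below the two components, which close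
  the infinite sequence of empty rows.\<close>

definition boundary :: "int \<Rightarrow> nat \<Rightarrow> int" where
  "boundary i n = of_bool (0 < n \<and> content 0 mod e = i) + of_bool (N < n \<and> content N mod e = i)"

sublocale word_crystal e "2 * N" boundary
  by unfold_locales (use l_pos in \<open>auto simp: boundary_def\<close>)

definition addable_slot :: "node set \<Rightarrow> int \<Rightarrow> nat \<Rightarrow> bool" where
  "addable_slot Y i p \<longleftrightarrow> p < 2 * N \<and> (top_slot p \<or> len Y p < len Y (Suc p)) \<and> (word Y p + 1) mod e = i"

definition removable_slot :: "node set \<Rightarrow> int \<Rightarrow> nat \<Rightarrow> bool" where
  "removable_slot Y i p \<longleftrightarrow> p < 2 * N \<and> 0 < len Y p \<and> len Y (p - 1) < len Y p \<and> word Y p mod e = i"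

lemma addable_res_iff:
  assumes "bip Y"
  shows "addable Y y \<and> res l y = i \<longleftrightarrow> (\<exists>p. addable_slot Y i p \<and> y = nd p (Suc (len Y p)))"
  unfolding addable_iff[OF assms] addable_slot_def word_def
  by (auto simp: res_nd algebra_simps)

lemma removable_res_iff:
  assumes "bip Y"
  shows "removable Y x \<and> res l x = i \<longleftrightarrow> (\<exists>p. removable_slot Y i p \<and> x = nd p (len Y p))"
  unfolding removable_iff[OF assms] removable_slot_def word_def
  by (auto simp: res_nd)

lemma mod_Suc_neq: "(v + 1) mod e \<noteq> v mod e"
proof -
  have "\<not> e dvd 1" using l_pos by (auto dest: zdvd_imp_le)
  then show ?thesis by (rule mod_diff_neq)
qed

lemma not_addable_removable_slot: "\<not> (addable_slot Y i p \<and> removable_slot Y i p)"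
  using mod_Suc_neq[of "word Y p"] unfolding addable_slot_def removable_slot_def by metis

lemma card_between:
  assumes P: "\<And>z. P z \<longleftrightarrow> (\<exists>t. Q t \<and> z = nd t (f t))" and Q: "\<And>t. Q t \<Longrightarrow> t < 2 * N"
    and "s < 2 * N" "p < 2 * N"
  shows "card {z. P z \<and> below (nd s c) z \<and> below z (nd p c')} = card {t. s < t \<and> t < p \<and> Q t}"
proof -
  have "P z \<and> below (nd s c) z \<and> below z (nd p c') \<longleftrightarrow> (\<exists>t. (s < t \<and> t < p \<and> Q t) \<and> z = nd t (f t))" for z
    unfolding P using below_nd[OF assms(3) Q] below_nd[OF Q assms(4)] by blast
  then have "{z. P z \<and> below (nd s c) z \<and> below z (nd p c')} = (\<lambda>t. nd t (f t)) ` {t. s < t \<and> t < p \<and> Q t}"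
    by (simp add: image_def conj_commute)
  moreover have "inj_on (\<lambda>t. nd t (f t)) {t. s < t \<and> t < p \<and> Q t}"
    by (intro inj_onI) (simp add: nd_inject Q)
  ultimately show ?thesis by (simp add: card_image)
qed

lemma normal_iff:
  assumes "bip Y" "p < 2 * N"
  shows "normal l Y i (nd p (len Y p)) \<longleftrightarrow> normal_slot (addable_slot Y i) (removable_slot Y i) p"
proof -
  have rm: "removable Y (nd p (len Y p)) \<and> res l (nd p (len Y p)) = i \<longleftrightarrow> removable_slot Y i p"
  proof
    assume "removable Y (nd p (len Y p)) \<and> res l (nd p (len Y p)) = i"
    then obtain t where "removable_slot Y i t" "nd p (len Y p) = nd t (len Y t)"
      using removable_res_iff[OF assms(1)] by blast
    then show "removable_slot Y i p" using assms(2) nd_inject[of p t] unfolding removable_slot_def by auto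
  next
    assume "removable_slot Y i p"
    then show "removable Y (nd p (len Y p)) \<and> res l (nd p (len Y p)) = i"
      using removable_res_iff[OF assms(1)] by blast
  qed
  have lt: "addable_slot Y i t \<Longrightarrow> t < 2 * N" "removable_slot Y i t \<Longrightarrow> t < 2 * N" for t
    unfolding addable_slot_def removable_slot_def by auto
  let ?x = "nd p (len Y p)"
  have card_r: "card {z. removable Y z \<and> res l z = i \<and> below (nd s c) z \<and> below z ?x}
      = card {t. s < t \<and> t < p \<and> removable_slot Y i t}" if "s < 2 * N" for s c
    using card_between[where P = "\<lambda>z. removable Y z \<and> res l z = i", OF removable_res_iff[OF assms(1)] lt(2) that assms(2)]
    by (simp only: conj_assoc)
  have card_a: "card {z. addable Y z \<and> res l z = i \<and> below (nd s c) z \<and> below z ?x}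
      = card {t. s < t \<and> t < p \<and> addable_slot Y i t}" if "s < 2 * N" for s c
    using card_between[where P = "\<lambda>z. addable Y z \<and> res l z = i", OF addable_res_iff[OF assms(1)] lt(1) that assms(2)]
    by (simp only: conj_assoc)
  have "(\<forall>y. addable Y y \<and> res l y = i \<and> below y ?x \<longrightarrow>
        card {z. removable Y z \<and> res l z = i \<and> below y z \<and> below z ?x}
        > card {z. addable Y z \<and> res l z = i \<and> below y z \<and> below z ?x})
     \<longleftrightarrow> (\<forall>s<p. addable_slot Y i s \<longrightarrow> card {t. s < t \<and> t < p \<and> removable_slot Y i t}
        > card {t. s < t \<and> t < p \<and> addable_slot Y i t})" (is "?A \<longleftrightarrow> ?B")
  proof
    assume A: ?A
    show ?B
    proof (intro allI impI)
      fix s assume s: "s < p" "addable_slot Y i s"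
      then have "addable Y (nd s (Suc (len Y s))) \<and> res l (nd s (Suc (len Y s))) = i"
        using addable_res_iff[OF assms(1)] by blast
      moreover have "s < 2 * N" "below (nd s (Suc (len Y s))) ?x" using s assms(2) by (auto simp: below_nd)
      ultimately show "card {t. s < t \<and> t < p \<and> removable_slot Y i t}
        > card {t. s < t \<and> t < p \<and> addable_slot Y i t}"
        using spec[OF A, of "nd s (Suc (len Y s))"] card_r[OF \<open>s < 2 * N\<close>] card_a[OF \<open>s < 2 * N\<close>]
        by simp
    qed
  next
    assume B: ?B
    show ?A
    proof (intro allI impI)
      fix y assume y: "addable Y y \<and> res l y = i \<and> below y ?x"
      then obtain s where s: "addable_slot Y i s" "y = nd s (Suc (len Y s))"
        using addable_res_iff[OF assms(1)] by blast
      have "s < 2 * N" "s < p" using y s lt(1)[OF s(1)] assms(2) by (auto simp: below_nd)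
      then show "card {z. removable Y z \<and> res l z = i \<and> below y z \<and> below z ?x}
        > card {z. addable Y z \<and> res l z = i \<and> below y z \<and> below z ?x}"
        using B s card_r[OF \<open>s < 2 * N\<close>] card_a[OF \<open>s < 2 * N\<close>] by simp
    qed
  qed
  then show ?thesis unfolding normal_def normal_slot_def using rm by blast
qed

lemma good_iff_walk:
  assumes "bip Y"
  shows "good l Y x \<and> res l x = i \<longleftrightarrow>
    (\<exists>p. x = nd p (len Y p) \<and> first_min (2 * N) (walk (addable_slot Y i) (removable_slot Y i)) p)"
proof -
  let ?n = "normal_slot (addable_slot Y i) (removable_slot Y i)"
  have gs: "?n p \<and> (\<forall>z. ?n z \<longrightarrow> z \<le> p) \<longleftrightarrow>
      first_min (2 * N) (walk (addable_slot Y i) (removable_slot Y i)) p" for p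
    by (rule good_slot_iff) (use not_addable_removable_slot in \<open>auto simp: removable_slot_def\<close>)
  have nlt: "p < 2 * N" if "?n p" for p
    using that unfolding normal_slot_def removable_slot_def by blast
  have nn: "\<exists>p. x = nd p (len Y p) \<and> ?n p" if "normal l Y i x" for x
  proof -
    have "removable Y x \<and> res l x = i" using that unfolding normal_def by blast
    then obtain p where "removable_slot Y i p" "x = nd p (len Y p)" using removable_res_iff[OF assms] by blast
    then show ?thesis using that normal_iff[OF assms] unfolding removable_slot_def by blast
  qed
  show ?thesis
  proof
    assume g: "good l Y x \<and> res l x = i"
    then obtain p where p: "x = nd p (len Y p)" "?n p" using nn unfolding good_def by blast
    have "z \<le> p" if z: "?n z" for z
    proof -
      have "normal l Y i (nd z (len Y z))" using z normal_iff[OF assms nlt[OF z]] by simp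
      then have "nd z (len Y z) = x \<or> below (nd z (len Y z)) x" using g unfolding good_def by blast
      then show ?thesis using nlt z p by (auto simp: nd_inject below_nd)
    qed
    then show "\<exists>p. x = nd p (len Y p) \<and> first_min (2 * N) (walk (addable_slot Y i) (removable_slot Y i)) p"
      using p gs by blast
  next
    assume "\<exists>p. x = nd p (len Y p) \<and> first_min (2 * N) (walk (addable_slot Y i) (removable_slot Y i)) p"
    then obtain p where p: "x = nd p (len Y p)" "?n p" "\<And>z. ?n z \<Longrightarrow> z \<le> p" using gs by blast
    have n: "normal l Y i x" using p normal_iff[OF assms nlt] by simp
    then have r: "res l x = i" unfolding normal_def by blast
    moreover have "z = x \<or> below z x" if z: "normal l Y i z" for z
    proof -
      obtain t where t: "z = nd t (len Y t)" "?n t" using nn z by blast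
      then have "t = p \<or> t < p" using p(3) by force
      then show ?thesis using t p nlt by (auto simp: below_nd)
    qed
    ultimately show "good l Y x \<and> res l x = i" using n unfolding good_def by simp
  qed
qed

text \<open>Two adjacent rows of equal length give a fictitious addable end followed directly by a
  fictitious removable end of the same residue. The height therefore exceeds the true walk by 1
  exactly between the members of such a pair.\<close>

lemma height_eq_walk:
  assumes "bip Y" "n \<le> 2 * N"
  shows "height i (word Y) n = walk (addable_slot Y i) (removable_slot Y i) n
    + of_bool (0 < n \<and> \<not> top_slot (n - 1) \<and> len Y (n - 1) = len Y n \<and> (word Y (n - 1) + 1) mod e = i)"
  using assms(2)
proof (induction n)
  case 0
  then show ?case unfolding height_def by (simp add: walk_def boundary_def)
next
  case (Suc n)
  let ?sp = "\<lambda>n. 0 < n \<and> \<not> top_slot (n - 1) \<and> len Y (n - 1) = len Y n \<and> (word Y (n - 1) + 1) mod e = i"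
  have le: "len Y n \<le> len Y (Suc n)" if "\<not> top_slot n"
    using bip_diagram(2)[OF assms(1)] Suc.prems that unfolding shape_def top_slot_def by auto
  have a: "of_bool (addable_slot Y i n) + of_bool (?sp (Suc n)) = (of_bool ((word Y n + 1) mod e = i) :: int)"
    using Suc.prems le unfolding addable_slot_def by (cases "top_slot n") auto
  \<comment> \<open>A removable end is either real, or it closes a fictitious pair, or it belongs to
    the empty slot \<open>0\<close> or \<open>N\<close>, where the jump of \<open>boundary\<close>
    compensates it.\<close>
  have r: "of_bool (removable_slot Y i n) + of_bool (?sp n) + (boundary i (Suc n) - boundary i n)
      = of_bool (word Y n mod e = i)"
  proof (cases "n = 0 \<or> n = N")
    case True
    then have "len Y n = 0" using bip_diagram(3,4)[OF assms(1)] by auto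
    then have "\<not> removable_slot Y i n" "word Y n = content n" by (auto simp: removable_slot_def word_def)
    moreover have "\<not> ?sp n" using True by (auto simp: top_slot_def)
    ultimately show ?thesis using True N_pos by (auto simp: boundary_def)
  next
    case False
    then have nt: "\<not> top_slot (n - 1)" "0 < n" "n < 2 * N" using Suc.prems by (auto simp: top_slot_def)
    have "len Y (n - 1) \<le> len Y n"
      using bip_diagram(2)[OF assms(1)] nt False unfolding shape_def
      by (metis Suc_pred' )
    moreover have "word Y n = word Y (n - 1) + 1" if "len Y (n - 1) = len Y n"
      using that False nt by (auto simp: word_def content_def of_nat_diff)
    moreover have "boundary i (Suc n) = boundary i n" using False by (auto simp: boundary_def)
    ultimately show ?thesis using nt unfolding removable_slot_def
      by (cases "len Y (n - 1) = len Y n") auto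
  qed
  have "height i (word Y) (Suc n) = height i (word Y) n + (boundary i (Suc n) - boundary i n)
      + of_bool ((word Y n + 1) mod e = i) - of_bool (word Y n mod e = i)"
    by (simp add: height_def dstep_def)
  also have "\<dots> = walk (addable_slot Y i) (removable_slot Y i) (Suc n) + of_bool (?sp (Suc n))"
    using Suc a r by (simp add: walk_Suc)
  finally show ?case .
qed

text \<open>The height never lies below the walk and agrees with it after a real removable slot, so
  a first minimum of the walk is one of the height. The converse follows from existence and
  uniqueness of first minima.\<close>

lemma first_min_height_iff:
  assumes "bip Y"
  shows "first_min (2 * N) (height i (word Y)) p \<longleftrightarrow>
    first_min (2 * N) (walk (addable_slot Y i) (removable_slot Y i)) p"
proof -
  let ?T = "walk (addable_slot Y i) (removable_slot Y i)" and ?H = "height i (word Y)"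
  have ge: "?T n \<le> ?H n" if "n \<le> 2 * N" for n using height_eq_walk[OF assms that] by simp
  have TH: "first_min (2 * N) ?H q" if T: "first_min (2 * N) ?T q" for q
  proof -
    have q: "q < 2 * N" "?T (Suc q) < ?T q" using T unfolding first_min_def by auto
    then have "removable_slot Y i q" by (auto simp: walk_Suc of_bool_def split: if_splits)
    then have "(word Y q + 1) mod e \<noteq> i" using mod_Suc_neq[of "word Y q"] unfolding removable_slot_def by metis
    then have H: "?H (Suc q) = ?T (Suc q)" using height_eq_walk[OF assms, of "Suc q"] q(1) by simp
    show ?thesis
      unfolding first_min_def H
    proof (intro conjI allI impI)
      fix n
      show "?T (Suc q) < ?H n" if "n \<le> q"
      proof -
        have "?T (Suc q) < ?T n" using T that unfolding first_min_def by blast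
        also have "\<dots> \<le> ?H n" using ge that q(1) by simp
        finally show ?thesis .
      qed
      show "?T (Suc q) \<le> ?H n" if "n \<le> 2 * N"
      proof -
        have "?T (Suc q) \<le> ?T n" using T that unfolding first_min_def by blast
        also have "\<dots> \<le> ?H n" using ge that by simp
        finally show ?thesis .
      qed
    qed (rule q(1))
  qed
  have "first_min (2 * N) ?T p" if H: "first_min (2 * N) ?H p"
  proof -
    have p: "p < 2 * N" "?H (Suc p) < ?H 0" using H unfolding first_min_def by auto
    have "?H 0 = 0" "?T 0 = 0" unfolding height_def by (simp_all add: boundary_def walk_def)
    then have "?T (Suc p) < ?T 0" using ge[of "Suc p"] p by simp
    then obtain q where "first_min (2 * N) ?T q"
      using first_min_exists[of "Suc p" "2 * N" ?T] p by auto
    then show ?thesis using TH H first_min_unique by blast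
  qed
  then show ?thesis using TH by blast
qed

lemma good_iff:
  assumes "bip Y"
  shows "good l Y x \<and> res l x = i \<longleftrightarrow>
    (\<exists>p. x = nd p (len Y p) \<and> first_min (2 * N) (height i (word Y)) p)"
  unfolding good_iff_walk[OF assms] first_min_height_iff[OF assms] ..

end


section \<open>Closure under removal of good nodes\<close>

definition gstep :: "nat \<Rightarrow> node set \<Rightarrow> node set \<Rightarrow> bool" where
  "gstep l Y Z \<longleftrightarrow> (\<exists>x. good l Y x \<and> Z = Y - {x})"

lemma good_removable: "good l Y x \<Longrightarrow> removable Y x"
  by (simp add: good_def normal_def)

lemma gstep_bipartition:
  assumes "gstep l Y Z"
  shows "is_bipartition Z" "finite Y \<Longrightarrow> card Z < card Y"
proof -
  obtain x where x: "good l Y x" "Z = Y - {x}" using assms unfolding gstep_def by blast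
  then have "x \<in> Y" "is_bipartition (Y - {x})"
    using good_removable[OF x(1)] unfolding removable_def by auto
  then show "is_bipartition Z" "finite Y \<Longrightarrow> card Z < card Y"
    using x(2) card_Diff1_less[of Y x] by auto
qed

text \<open>Forgetting residues and reversing paths turns closure under good removal into a question
  of confluence.\<close>

lemma kleshchev_iff_gstep:
  assumes "is_bipartition Y"
  shows "kleshchev l Y \<longleftrightarrow> (gstep l)\<^sup>*\<^sup>* Y {}"
proof
  have "(gstep l)\<^sup>*\<^sup>* Y {}" if "reach l is Y" "is_bipartition Y" for "is" Y
    using that
  proof induction
    case (reach_step "is" Y x)
    then have "gstep l (insert x Y) Y" unfolding gstep_def by (intro exI[of _ x]) simp
    moreover have "is_bipartition Y" using calculation by (rule gstep_bipartition)
    ultimately show ?case using reach_step.IH by (meson converse_rtranclp_into_rtranclp)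
  qed simp
  then show "kleshchev l Y \<Longrightarrow> (gstep l)\<^sup>*\<^sup>* Y {}" using assms unfolding kleshchev_def by blast
next
  show "(gstep l)\<^sup>*\<^sup>* Y {} \<Longrightarrow> kleshchev l Y"
  proof (induction rule: converse_rtranclp_induct)
    case base
    show ?case unfolding kleshchev_def using reach_empty by blast
  next
    case (step Y Z)
    then obtain x where x: "good l Y x" "Z = Y - {x}" unfolding gstep_def by blast
    then have "Y = insert x Z" "x \<notin> Z" using good_removable unfolding removable_def by blast+
    moreover obtain "is" where "reach l is Z" using step unfolding kleshchev_def by blast
    ultimately show ?case unfolding kleshchev_def using x(1) reach_step by blast
  qed
qed

context abacus
begin

lemma good_estep:
  assumes "bip Y" "good l Y x"
  shows "bip (Y - {x})" "estep (res l x) (word Y) (word (Y - {x}))"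
proof -
  obtain p where p: "x = nd p (len Y p)" "first_min (2 * N) (height (res l x) (word Y)) p"
    using good_iff[OF assms(1)] assms(2) by blast
  obtain q where q: "q < 2 * N" "x = nd q (len Y q)"
    "bip (Y - {x})" "word (Y - {x}) = dec q (word Y)"
    using removableE[OF assms(1) good_removable[OF assms(2)]] by metis
  have "p < 2 * N" using p(2) by (simp add: first_min_def)
  then have "p = q" using p(1) q(1,2) nd_inject by metis
  then show "bip (Y - {x})" "estep (res l x) (word Y) (word (Y - {x}))"
    using p q unfolding estep_def by auto
qed

lemma estep_good:
  assumes "bip Y" "estep i (word Y) g"
  shows "\<exists>x. good l Y x \<and> bip (Y - {x}) \<and> word (Y - {x}) = g"
proof -
  obtain p where p: "first_min (2 * N) (height i (word Y)) p" "g = dec p (word Y)"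
    using assms(2) unfolding estep_def by blast
  then have g: "good l Y (nd p (len Y p))" "res l (nd p (len Y p)) = i"
    using good_iff[OF assms(1)] by blast+
  have "estep i (word Y) (word (Y - {nd p (len Y p)}))" "bip (Y - {nd p (len Y p)})"
    using good_estep[OF assms(1) g(1)] g(2) by auto
  moreover have "word (Y - {nd p (len Y p)}) = g"
    using calculation(1) p first_min_unique unfolding estep_def by blast
  ultimately show ?thesis using g by blast
qed

lemma estep_star_gstep:
  assumes "estep_any\<^sup>*\<^sup>* (word Y) g" "bip Y"
  shows "\<exists>Z. (gstep l)\<^sup>*\<^sup>* Y Z \<and> bip Z \<and> word Z = g"
  using assms
proof (induction rule: rtranclp_induct)
  case (step g g')
  then obtain Z i where Z: "(gstep l)\<^sup>*\<^sup>* Y Z" "bip Z" "word Z = g" "estep i g g'"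
    unfolding estep_any_def by blast
  then obtain x where "good l Z x" "bip (Z - {x})" "word (Z - {x}) = g'"
    using estep_good by blast
  moreover from this have "gstep l Z (Z - {x})" unfolding gstep_def by blast
  then have "(gstep l)\<^sup>*\<^sup>* Y (Z - {x})" by (rule rtranclp.rtrancl_into_rtrancl[OF Z(1)])
  ultimately show ?case by blast
qed blast

lemma gstep_confluent_bip:
  assumes "2 \<le> l" "bip Y" "gstep l Y Y1" "gstep l Y Y2"
  shows "\<exists>Z. (gstep l)\<^sup>*\<^sup>* Y1 Z \<and> (gstep l)\<^sup>*\<^sup>* Y2 Z"
proof -
  have s: "bip Z \<and> (\<exists>i. estep i (word Y) (word Z))" if "gstep l Y Z" for Z
    using that good_estep[OF assms(2)] unfolding gstep_def by blast
  obtain i1 i2 where i: "bip Y1" "estep i1 (word Y) (word Y1)" "bip Y2" "estep i2 (word Y) (word Y2)"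
    using s assms(3,4) by blast
  then obtain g where "estep_any\<^sup>*\<^sup>* (word Y1) g" "estep_any\<^sup>*\<^sup>* (word Y2) g"
    using estep_confluent[of i1 "word Y" "word Y1" i2 "word Y2"] assms(1) by auto
  then obtain Z1 Z2 where "(gstep l)\<^sup>*\<^sup>* Y1 Z1" "bip Z1" "word Z1 = g"
    "(gstep l)\<^sup>*\<^sup>* Y2 Z2" "bip Z2" "word Z2 = g" using estep_star_gstep i by metis
  then show ?thesis using word_inject by metis
qed

lemma good_source_unique:
  assumes "bip Y" "bip Y'" "good l Y x" "good l Y' x'" "res l x = res l x'" "Y - {x} = Y' - {x'}"
  shows "Y = Y'"
proof -
  have "estep (res l x) (word Y) (word (Y - {x}))" "estep (res l x) (word Y') (word (Y - {x}))"
    using good_estep assms by metis+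
  then show ?thesis using estep_source_unique word_inject assms(1,2) by blast
qed

end

text \<open>A common \<open>N\<close> for both bipartitions makes their words comparable slot by
  slot.\<close>

lemma bipartition_abacus:
  assumes "is_bipartition Y" "is_bipartition Z" "1 \<le> l"
  obtains N where "abacus l N" "abacus.bip N Y" "abacus.bip N Z"
proof -
  define N where "N = Suc (Max (insert 0 (fst ` (Y \<union> Z))))"
  have fin: "finite (insert 0 (fst ` (Y \<union> Z)))" using assms unfolding is_bipartition_def by simp
  have ab: "abacus l N" using assms(3) by unfold_locales (auto simp: N_def)
  have lt: "r < N" if "(r, c, k) \<in> Y \<union> Z" for r c k
  proof -
    have "r \<in> insert 0 (fst ` (Y \<union> Z))" using that by force
    then show ?thesis using Max_ge[OF fin] unfolding N_def by (simp only: less_Suc_eq_le)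
  qed
  have "abacus.bip N Y" "abacus.bip N Z"
    using assms lt unfolding abacus.bip_def[OF ab] by blast+
  with ab show ?thesis using that by blast
qed

lemma gstep_confluent:
  assumes "2 \<le> l" "is_bipartition Y" "gstep l Y Y1" "gstep l Y Y2"
  shows "\<exists>Z. (gstep l)\<^sup>*\<^sup>* Y1 Z \<and> (gstep l)\<^sup>*\<^sup>* Y2 Z"
proof -
  obtain N where "abacus l N" "abacus.bip N Y"
    using bipartition_abacus[OF assms(2,2), of l] assms(1) by auto
  then show ?thesis using abacus.gstep_confluent_bip assms by blast
qed

text \<open>The induction of Newman's lemma on the number of nodes. The first steps towards
  \<open>{}\<close> and towards \<open>Z\<close> join in some \<open>W\<close>; the hypothesis for
  \<open>Y1\<close> takes \<open>W\<close> to \<open>{}\<close>, hence \<open>Y2\<close> reaches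
  \<open>{}\<close>, and the hypothesis for \<open>Y2\<close> takes \<open>Z\<close> there.\<close>

lemma gstep_star_empty:
  assumes "2 \<le> l" "is_bipartition Y" "(gstep l)\<^sup>*\<^sup>* Y {}" "(gstep l)\<^sup>*\<^sup>* Y Z"
  shows "(gstep l)\<^sup>*\<^sup>* Z {}"
  using assms(2-4)
proof (induction "card Y" arbitrary: Y Z rule: less_induct)
  case less
  show ?case
  proof (cases "Y = Z")
    case False
    then obtain Y2 where Y2: "gstep l Y Y2" "(gstep l)\<^sup>*\<^sup>* Y2 Z"
      using less.prems(3) by (metis converse_rtranclpE)
    have "Y \<noteq> {}" using Y2(1) good_removable unfolding gstep_def removable_def by blast
    then obtain Y1 where Y1: "gstep l Y Y1" "(gstep l)\<^sup>*\<^sup>* Y1 {}"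
      using less.prems(2) by (metis converse_rtranclpE)
    obtain W where W: "(gstep l)\<^sup>*\<^sup>* Y1 W" "(gstep l)\<^sup>*\<^sup>* Y2 W"
      using gstep_confluent[OF assms(1) less.prems(1) Y1(1) Y2(1)] by blast
    have fin: "finite Y" using less.prems(1) unfolding is_bipartition_def by blast
    note s1 = gstep_bipartition[OF Y1(1)] and s2 = gstep_bipartition[OF Y2(1)]
    have "(gstep l)\<^sup>*\<^sup>* W {}" using less.hyps[OF s1(2)[OF fin] s1(1) Y1(2) W(1)] .
    then have "(gstep l)\<^sup>*\<^sup>* Y2 {}" using W(2) by (meson rtranclp_trans)
    then show ?thesis using less.hyps[OF s2(2)[OF fin] s2(1) _ Y2(2)] by blast
  qed (use less.prems in simp)
qed

context abacus
begin

text \<open>For \<open>l = 1\<close> these are the Kleshchev bipartitions: both components are \<open>2\<close>-restricted, and the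
  first one has at most one row more than the second one has columns.\<close>

definition restricted_pair :: "node set \<Rightarrow> bool" where
  "restricted_pair Y \<longleftrightarrow> bip Y \<and>
     (\<forall>p. Suc p < 2 * N \<longrightarrow> Suc p \<noteq> N \<longrightarrow> len Y (Suc p) \<le> len Y p + 1) \<and>
     (\<forall>p. N \<le> p \<longrightarrow> p < 2 * N \<longrightarrow> 0 < len Y p \<longrightarrow> 2 * N - p \<le> len Y (N - 1) + 1)"

abbreviation "sig_walk Y i \<equiv> walk (addable_slot Y i) (removable_slot Y i)"

lemma sig_walk_removable: "removable_slot Y i p \<Longrightarrow> sig_walk Y i (Suc p) = sig_walk Y i p - 1"
  using not_addable_removable_slot[of Y i p] by (simp add: walk_Suc)

lemma sig_walk_addable: "addable_slot Y i p \<Longrightarrow> sig_walk Y i (Suc p) = sig_walk Y i p + 1"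
  using not_addable_removable_slot[of Y i p] by (simp add: walk_Suc)

lemma sig_walk_const:
  assumes "m \<le> n" "\<And>t. m \<le> t \<Longrightarrow> t < n \<Longrightarrow> \<not> addable_slot Y i t \<and> \<not> removable_slot Y i t"
  shows "sig_walk Y i n = sig_walk Y i m"
  using assms
proof (induction n rule: dec_induct)
  case (step n)
  then have "\<not> addable_slot Y i n \<and> \<not> removable_slot Y i n" by simp
  then show ?case using step by (simp add: walk_Suc)
qed simp

lemma goodE:
  assumes "bip Y" "good l Y x"
  obtains p where "p < 2 * N" "x = nd p (len Y p)" "p \<noteq> 0" "p \<noteq> N" "removable_slot Y (res l x) p"
    "first_min (2 * N) (sig_walk Y (res l x)) p" "res l x = word Y p mod e"
    "bip (Y - {x})" "\<And>q. q < 2 * N \<Longrightarrow> len (Y - {x}) q = (if q = p then len Y p - 1 else len Y q)"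
proof -
  obtain p where p: "x = nd p (len Y p)" "first_min (2 * N) (sig_walk Y (res l x)) p"
    using good_iff_walk[OF assms(1)] assms(2) by blast
  then have pM: "p < 2 * N" "sig_walk Y (res l x) (Suc p) < sig_walk Y (res l x) p"
    unfolding first_min_def by auto
  then have r: "removable_slot Y (res l x) p" by (auto simp: walk_Suc of_bool_def split: if_splits)
  then have "p \<noteq> 0" "p \<noteq> N" using bip_diagram(3,4)[OF assms(1)] unfolding removable_slot_def by (metis less_irrefl)+
  moreover have "bip (Y - {x})" using good_estep assms by blast
  moreover have "res l x = word Y p mod e" using r unfolding removable_slot_def by simp
  moreover have "len (Y - {x}) q = (if q = p then len Y p - 1 else len Y q)" if "q < 2 * N" for q
    using len_delete[OF assms(1) pM(1) that] p(1) by simp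
  ultimately show ?thesis using that p pM(1) r by blast
qed

text \<open>If an inequality broke, a later slot would hold a removable node of the same residue
  with no net rise of the walk in between. The walk would then fall below the minimum reached just
  after the good slot.\<close>

lemma restricted_pair_delete:
  assumes l1: "l = 1" and Y: "restricted_pair Y" and g: "good l Y x"
  shows "restricted_pair (Y - {x})"
proof -
  have b: "bip Y" and restr: "\<And>p. Suc p < 2 * N \<Longrightarrow> Suc p \<noteq> N \<Longrightarrow> len Y (Suc p) \<le> len Y p + 1"
    and rows: "\<And>p. N \<le> p \<Longrightarrow> p < 2 * N \<Longrightarrow> 0 < len Y p \<Longrightarrow> 2 * N - p \<le> len Y (N - 1) + 1"
    using Y unfolding restricted_pair_def by auto
  obtain p where p: "p < 2 * N" "x = nd p (len Y p)" "p \<noteq> 0" "p \<noteq> N" "removable_slot Y (res l x) p"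
    "first_min (2 * N) (sig_walk Y (res l x)) p" "res l x = word Y p mod e"
    and b': "bip (Y - {x})"
    and len': "\<And>q. q < 2 * N \<Longrightarrow> len (Y - {x}) q = (if q = p then len Y p - 1 else len Y q)"
    using goodE[OF b g] by metis
  define i where "i = res l x"
  have lp: "0 < len Y p" using p(5) unfolding removable_slot_def by blast
  have fm: "sig_walk Y i (Suc p) \<le> sig_walk Y i n" if "n \<le> 2 * N" for n
    using p(6) that unfolding first_min_def i_def by blast
  have iw: "i = word Y p mod 2" using p(7) l1 by (simp add: i_def)
  have "len (Y - {x}) (Suc q) \<le> len (Y - {x}) q + 1" if q: "Suc q < 2 * N" "Suc q \<noteq> N" for q
  proof (cases "q = p")
    case True
    have "len Y (Suc p) \<noteq> Suc (len Y p)"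
    proof
      assume S: "len Y (Suc p) = Suc (len Y p)"
      then have "word Y (Suc p) = word Y p + 2" using q True p(4) by (auto simp: word_def content_def)
      then have "removable_slot Y i (Suc p)"
        using q True S l1 iw unfolding removable_slot_def by simp
      then show False using fm[of "Suc (Suc p)"] sig_walk_removable q True by fastforce
    qed
    then show ?thesis using restr[OF q] len'[of q] len'[of "Suc q"] q True by auto
  next
    case False
    then show ?thesis using restr[OF q] len'[of q] len'[of "Suc q"] q by auto
  qed
  moreover have "2 * N - q \<le> len (Y - {x}) (N - 1) + 1"
    if q: "N \<le> q" "q < 2 * N" "0 < len (Y - {x}) q" for q
  proof (rule ccontr)
    assume C: "\<not> ?thesis"
    have lq: "0 < len Y q" using q len'[of q] by (auto split: if_splits)
    then have ub: "2 * N - q \<le> len Y (N - 1) + 1" using rows q by blast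
    have "len (Y - {x}) (N - 1) = (if N - 1 = p then len Y p - 1 else len Y (N - 1))"
      by (rule len') (use N_pos in linarith)
    \<comment> \<open>Only shortening the first row of the second component can violate the bound on
      rows, and only if row \<open>2 * N - q\<close> attained it.\<close>
    then have pN: "p = N - 1" and qc: "2 * N - q = len Y p + 1" using C ub lp by (auto split: if_splits)
    have z: "len Y t = 0" if "N \<le> t" "t < q" for t
      using rows[of t] that q qc pN by (cases "len Y t = 0") auto
    have "q \<noteq> N" using lq bip_diagram(4)[OF b] by auto
    then have q1: "N \<le> q - 1" "Suc (q - 1) = q" using q by auto
    then have lq1: "len Y q = 1" using restr[of "q - 1"] z[of "q - 1"] lq q \<open>q \<noteq> N\<close> by auto
    \<comment> \<open>With \<open>c = len Y p\<close> the ends of the rows \<open>q\<close> and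
      \<open>p\<close> have unreduced residues \<open>- c\<close> and \<open>c\<close>, which agree
      modulo 2.\<close>
    have wq: "word Y q = - int (len Y p)"
      using lq1 qc q by (simp add: word_def content_def)
    have wp: "word Y p = int (len Y p)" unfolding word_def content_def using pN N_pos l1 by (simp add: of_nat_diff)
    have "word Y q mod 2 = i" using wq wp iw by presburger
    then have "removable_slot Y i q"
      using lq1 z[of "q - 1"] q1 q l1 unfolding removable_slot_def by simp
    then have "sig_walk Y i (Suc q) = sig_walk Y i q - 1" by (rule sig_walk_removable)
    also have "sig_walk Y i q = sig_walk Y i N"
    proof (rule sig_walk_const[OF q(1)])
      fix t assume t: "N \<le> t" "t < q"
      have "\<not> addable_slot Y i t"
      proof
        assume a: "addable_slot Y i t"
        have "\<not> top_slot t" using t q(2) by (auto simp: top_slot_def)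
        then have "len Y t < len Y (Suc t)" using a unfolding addable_slot_def by blast
        then have "Suc t = q" using z[of "Suc t"] t by (cases "Suc t = q") auto
        then have "word Y t + 1 = - int (len Y p) - 1"
          using z[OF t] t qc by (auto simp: word_def content_def of_nat_diff)
        moreover have "(word Y t + 1) mod 2 = i" using a l1 unfolding addable_slot_def by simp
        ultimately show False using wp iw by presburger
      qed
      then show "\<not> addable_slot Y i t \<and> \<not> removable_slot Y i t"
        using z[OF t] unfolding removable_slot_def by simp
    qed
    finally show False using fm[of "Suc q"] q pN N_pos by simp
  qed
  ultimately show ?thesis using b' unfolding restricted_pair_def by blast
qed

text \<open>Dual to deletion: a violation caused by \<open>x\<close> yields an earlier addable slot
  of the same residue, with no entry of that residue between it and \<open>x\<close>. After
  \<open>x\<close> the walk merely returns to its value before that slot, so \<open>x\<close> is not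
  a record low.\<close>

lemma restricted_pair_insert:
  assumes l1: "l = 1" and b: "bip Y" and g: "good l Y x" and Y: "restricted_pair (Y - {x})"
  shows "restricted_pair Y"
proof -
  obtain p where p: "p < 2 * N" "x = nd p (len Y p)" "p \<noteq> 0" "p \<noteq> N" "removable_slot Y (res l x) p"
    "first_min (2 * N) (sig_walk Y (res l x)) p" "res l x = word Y p mod e"
    and b': "bip (Y - {x})"
    and len': "\<And>q. q < 2 * N \<Longrightarrow> len (Y - {x}) q = (if q = p then len Y p - 1 else len Y q)"
    using goodE[OF b g] by metis
  have restr: "len (Y - {x}) (Suc p) \<le> len (Y - {x}) p + 1" if "Suc p < 2 * N" "Suc p \<noteq> N" for p
    using Y that unfolding restricted_pair_def by blast
  have rows: "2 * N - p \<le> len (Y - {x}) (N - 1) + 1" if "N \<le> p" "p < 2 * N" "0 < len (Y - {x}) p" for p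
    using Y that unfolding restricted_pair_def by blast
  define i where "i = res l x"
  have rs: "removable_slot Y i p" and lp: "0 < len Y p" "len Y (p - 1) < len Y p"
    using p(5) unfolding removable_slot_def i_def by auto
  have fm: "sig_walk Y i (Suc p) < sig_walk Y i n" if "n \<le> p" for n
    using p(6) that unfolding first_min_def i_def by blast
  have iw: "i = word Y p mod 2" using p(7) l1 by (simp add: i_def)
  have "len Y (Suc q) \<le> len Y q + 1" if q: "Suc q < 2 * N" "Suc q \<noteq> N" for q
  proof (cases "Suc q = p")
    case True
    have "len Y p \<noteq> len Y q + 2"
    proof
      assume S: "len Y p = len Y q + 2"
      then have "word Y q + 1 = word Y p - 2"
        using q True by (auto simp: word_def content_def)
      then have "(word Y q + 1) mod 2 = i" using iw by presburger
      then have "addable_slot Y i q"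
        using q True S l1 unfolding addable_slot_def by simp
      then have "sig_walk Y i p = sig_walk Y i q + 1" using sig_walk_addable True by blast
      then show False using fm[of q] sig_walk_removable[OF rs] True by simp
    qed
    then show ?thesis using restr[OF q] len'[of q] len'[of "Suc q"] q True by auto
  next
    case False
    then show ?thesis using restr[OF q] len'[of q] len'[of "Suc q"] q by (auto split: if_splits)
  qed
  moreover have "2 * N - q \<le> len Y (N - 1) + 1"
    if q: "N \<le> q" "q < 2 * N" "0 < len Y q" for q
  proof (rule ccontr)
    assume C: "\<not> ?thesis"
    define c where "c = len Y (N - 1)"
    have lN: "len (Y - {x}) (N - 1) = (if N - 1 = p then len Y p - 1 else len Y (N - 1))"
      by (rule len') (use N_pos in linarith)
    then have "len (Y - {x}) (N - 1) \<le> len Y (N - 1)" by (auto split: if_splits)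
    then have "len (Y - {x}) q = 0" using rows[OF q(1,2)] C by fastforce
    then have qp: "q = p" and lp1: "len Y p = 1" using len'[OF q(2)] q lp by (auto split: if_splits)
    have "N - 1 \<noteq> p" using q qp N_pos by auto
    then have cN: "len (Y - {x}) (N - 1) = c" using lN by (simp add: c_def)
    have "Suc p \<noteq> 2 * N" using C qp by auto
    then have Sp: "Suc p < 2 * N" "Suc p \<noteq> N" using p q qp by auto
    then have "len Y p \<le> len Y (Suc p)" using bip_diagram(2)[OF b] unfolding shape_def by blast
    then have "0 < len (Y - {x}) (Suc p)" using len'[OF Sp(1)] lp1 by simp
    then have "2 * N - Suc p \<le> c + 1" using rows[of "Suc p"] Sp q qp cN by simp
    then have pc: "2 * N - p = c + 2" using C qp by (simp add: c_def)
    have wp: "word Y p = - int c - 1" using pc lp1 q qp by (simp add: word_def content_def of_nat_diff)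
    have "word Y (N - 1) + 1 = int c + 1"
      unfolding word_def content_def using N_pos l1 by (simp add: of_nat_diff c_def)
    \<comment> \<open>The end of the first row of the second component is always addable; its
      residue \<open>c + 1\<close> agrees modulo 2 with the residue \<open>- c - 1\<close> of
      \<open>x\<close>.\<close>
    then have "addable_slot Y i (N - 1)"
      using wp iw l1 N_pos unfolding addable_slot_def top_slot_def by simp presburger
    then have a: "sig_walk Y i N = sig_walk Y i (N - 1) + 1" using sig_walk_addable[of Y i "N - 1"] N_pos by simp
    have z: "len Y t = 0" if "N \<le> t" "t < p" for t
    proof -
      have "len Y t \<le> len Y (p - 1)"
        by (rule diagram_slot_le[OF bip_diagram(2)[OF b]]) (use that p in auto)
      then show ?thesis using lp lp1 by simp
    qed
    have "sig_walk Y i p = sig_walk Y i N"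
    proof (rule sig_walk_const)
      show "N \<le> p" using q qp by simp
      fix t assume t: "N \<le> t" "t < p"
      have "\<not> addable_slot Y i t"
      proof
        assume a: "addable_slot Y i t"
        have "\<not> top_slot t" using t p(1) by (auto simp: top_slot_def)
        then have "len Y t < len Y (Suc t)" using a unfolding addable_slot_def by blast
        then have "Suc t = p" using z[of "Suc t"] t by (cases "Suc t = p") auto
        then have "word Y t + 1 = - int c - 2"
          using z[OF t] t pc by (auto simp: word_def content_def of_nat_diff)
        moreover have "(word Y t + 1) mod 2 = i" using a l1 unfolding addable_slot_def by simp
        ultimately show False using wp iw by presburger
      qed
      then show "\<not> addable_slot Y i t \<and> \<not> removable_slot Y i t"
        using z[OF t] unfolding removable_slot_def by simp
    qed
    moreover have "N - 1 \<le> p" using q qp by simp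
    ultimately show False using fm[of "N - 1"] a sig_walk_removable[OF rs] by simp
  qed
  ultimately show ?thesis using b unfolding restricted_pair_def by blast
qed

text \<open>The lowest non-empty row has length 1. No slot below it is addable for the residue of
  its only node, so the walk goes below its start value and a first minimum exists.\<close>

lemma restricted_pair_good:
  assumes l1: "l = 1" and Y: "restricted_pair Y" and ne: "Y \<noteq> {}"
  shows "\<exists>x. good l Y x"
proof -
  have b: "bip Y" and restr: "\<And>p. Suc p < 2 * N \<Longrightarrow> Suc p \<noteq> N \<Longrightarrow> len Y (Suc p) \<le> len Y p + 1"
    and rows: "\<And>p. N \<le> p \<Longrightarrow> p < 2 * N \<Longrightarrow> 0 < len Y p \<Longrightarrow> 2 * N - p \<le> len Y (N - 1) + 1"
    using Y unfolding restricted_pair_def by auto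
  have ex: "\<exists>p. p < 2 * N \<and> 0 < len Y p"
  proof -
    obtain x where "x \<in> Y" using ne by blast
    then obtain p c where "p < 2 * N" "1 \<le> c" "c \<le> len Y p" using mem_bipE[OF b] by metis
    then show ?thesis by (intro exI[of _ p]) linarith
  qed
  define q where "q = (LEAST p. p < 2 * N \<and> 0 < len Y p)"
  have q: "q < 2 * N" "0 < len Y q" using LeastI_ex[OF ex] unfolding q_def by auto
  have z: "len Y t = 0" if "t < q" for t
    using not_less_Least[of t "\<lambda>p. p < 2 * N \<and> 0 < len Y p"] that q(1) unfolding q_def[symmetric] by auto
  have q0: "q \<noteq> 0" "q \<noteq> N" using q(2) bip_diagram(3,4)[OF b] by (metis less_irrefl)+
  have q1: "Suc (q - 1) = q" using q0 by simp
  then have lq: "len Y q = 1" using restr[of "q - 1"] z[of "q - 1"] q q0 by auto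
  define i where "i = word Y q mod 2"
  have rs: "removable_slot Y i q" using q lq z[of "q - 1"] q0 l1 unfolding removable_slot_def i_def by simp
  \<comment> \<open>If the lowest non-empty row lies in the first component, the second is empty and
    the row bound leaves a single row.\<close>
  have qtop: "q < N \<or> Suc q = 2 * N"
  proof (cases "q < N")
    case False
    then have "2 * N - q \<le> len Y (N - 1) + 1" "len Y (N - 1) = 0" using rows[of q] q z[of "N - 1"] N_pos by auto
    then show ?thesis using q(1) by auto
  qed simp
  have "sig_walk Y i q = sig_walk Y i 0"
  proof (rule sig_walk_const)
    fix t assume t: "0 \<le> t" "t < q"
    have "\<not> addable_slot Y i t"
    proof
      assume a: "addable_slot Y i t"
      then have cs: "top_slot t \<or> Suc t = q" using z[of t] z[of "Suc t"] t(2) unfolding addable_slot_def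
        by (cases "Suc t = q") auto
      have "\<not> even (word Y t + 1 - word Y q)"
      proof (cases "Suc t = N")
        case True
        then have "Suc q = 2 * N" using qtop t by auto
        then show ?thesis unfolding word_def content_def using z[OF t(2)] lq True N_pos l1 q0 by auto
      next
        case False
        then have tq: "Suc t = q" using cs t q by (auto simp: top_slot_def)
        then show ?thesis using z[OF t(2)] lq False q0 by (auto simp: word_def content_def)
      qed
      moreover have "(word Y t + 1) mod 2 = i" using a l1 unfolding addable_slot_def by simp
      ultimately show False unfolding i_def by presburger
    qed
    then show "\<not> addable_slot Y i t \<and> \<not> removable_slot Y i t"
      using z[OF t(2)] unfolding removable_slot_def by simp
  qed simp
  then have "sig_walk Y i (Suc q) < sig_walk Y i 0" using sig_walk_removable[OF rs] by simp
  then obtain p where "first_min (2 * N) (sig_walk Y i) p"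
    using first_min_exists[of "Suc q" "2 * N" "sig_walk Y i"] q(1) by auto
  then show ?thesis using good_iff_walk[OF b] by blast
qed

lemma gstep_star_empty_iff:
  assumes "l = 1" "bip Y"
  shows "(gstep l)\<^sup>*\<^sup>* Y {} \<longleftrightarrow> restricted_pair Y"
proof
  assume "(gstep l)\<^sup>*\<^sup>* Y {}"
  then show "restricted_pair Y"
    using assms(2)
  proof (induction rule: converse_rtranclp_induct)
    case base
    then show ?case by (simp add: restricted_pair_def len_def)
  next
    case (step Y Z)
    then obtain x where x: "good l Y x" "Z = Y - {x}" unfolding gstep_def by blast
    then have "restricted_pair Z" using step good_estep by blast
    then show ?case using restricted_pair_insert[OF assms(1) step.prems x(1)] x(2) by simp
  qed
next
  show "restricted_pair Y \<Longrightarrow> (gstep l)\<^sup>*\<^sup>* Y {}"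
  proof (induction "card Y" arbitrary: Y rule: less_induct)
    case less
    show ?case
    proof (cases "Y = {}")
      case False
      then obtain x where x: "good l Y x" using restricted_pair_good[OF assms(1) less.prems] by blast
      then have s: "gstep l Y (Y - {x})" unfolding gstep_def by blast
      have "finite Y" using less.prems unfolding restricted_pair_def bip_def is_bipartition_def by blast
      then have "(gstep l)\<^sup>*\<^sup>* (Y - {x}) {}"
        using less.hyps gstep_bipartition(2)[OF s] restricted_pair_delete[OF assms(1) less.prems x] by blast
      then show ?thesis using s by (meson converse_rtranclp_into_rtranclp)
    qed simp
  qed
qed

end

lemma kleshchev_delete_good:
  assumes "1 \<le> l" "kleshchev l Y" "is_bipartition Y" "good l Y x"
  shows "kleshchev l (Y - {x})"
proof -
  have s: "gstep l Y (Y - {x})" using assms(4) unfolding gstep_def by blast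
  note bZ = gstep_bipartition(1)[OF s]
  have Y: "(gstep l)\<^sup>*\<^sup>* Y {}" using assms(2) kleshchev_iff_gstep[OF assms(3)] by blast
  have "(gstep l)\<^sup>*\<^sup>* (Y - {x}) {}"
  proof (cases "l = 1")
    case True
    obtain N where N: "abacus l N" "abacus.bip N Y" "abacus.bip N (Y - {x})"
      using bipartition_abacus[OF assms(3) bZ assms(1)] by blast
    interpret abacus l N by (rule N(1))
    have "restricted_pair Y" using Y gstep_star_empty_iff[OF True N(2)] by blast
    then have "restricted_pair (Y - {x})" by (rule restricted_pair_delete[OF True _ assms(4)])
    then show ?thesis using gstep_star_empty_iff[OF True N(3)] by blast
  next
    case False
    then show ?thesis using gstep_star_empty[OF _ assms(3) Y, of "Y - {x}"] assms(1) s by auto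
  qed
  then show ?thesis using kleshchev_iff_gstep[OF bZ] by blast
qed

section \<open>Paths are determined by their residues\<close>

lemma good_insert_unique:
  assumes "1 \<le> l" "is_bipartition Y" "is_bipartition Y'" "good l Y x" "good l Y' x'"
    "res l x = res l x'" "Y - {x} = Y' - {x'}"
  shows "Y = Y'"
  using bipartition_abacus[OF assms(2,3,1)] abacus.good_source_unique assms(4-) by metis

text \<open>Induction along the path: the sets before the last step are bipartitions, as they arise
  by removing a good node, and the last added node is determined by its residue and the set before
  it.\<close>

lemma reach_unique:
  assumes "1 \<le> l" "reach l is Y" "reach l is Y'" "is_bipartition Y" "is_bipartition Y'"
  shows "Y = Y'"
  using assms(2-)
proof (induction arbitrary: Y')
  case reach_empty
  then show ?case by (auto elim: reach.cases)
next
  case (reach_step "is" Y x)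
  from reach_step.prems(1) show ?case
  proof cases
    case (reach_step is' Z z)
    note z = this
    then have eq: "is' = is" "res l z = res l x" by auto
    have "is_bipartition Y" "is_bipartition Z"
      using good_removable[OF reach_step.hyps(3)] good_removable[OF z(5)] reach_step.hyps(2) z(4)
      unfolding removable_def by auto
    moreover have "Z = Y" using reach_step.IH z(3) eq(1) calculation by simp
    moreover have "insert x Y - {x} = insert z Y - {z}" using reach_step.hyps(2) z(4) \<open>Z = Y\<close> by simp
    ultimately show ?thesis
      using good_insert_unique[OF assms(1) reach_step.prems(2,3) reach_step.hyps(3)] z eq(2) by metis
  qed auto
qed

lemma reach_count:
  assumes "reach l is Y"
  shows "finite Y" "count_list is a = card {x \<in> Y. res l x = a}"
proof -
  have "finite Y \<and> count_list is a = card {x \<in> Y. res l x = a}"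
    using assms
  proof induction
    case (reach_step "is" Y x)
    have "{y \<in> insert x Y. res l y = a} = (if res l x = a then insert x {y \<in> Y. res l y = a} else {y \<in> Y. res l y = a})"
      by auto
    then show ?case using reach_step by simp
  qed simp
  then show "finite Y" "count_list is a = card {x \<in> Y. res l x = a}" by auto
qed

section \<open>Residue contents\<close>

text \<open>Each node differs from \<open>x\<close> or from \<open>y\<close>, so it survives in one
  of the two bipartitions together with the rectangle it spans. This is how two good nodes certify
  that a set reached by a path is a bipartition.\<close>

lemma is_bipartition_two_removable:
  assumes "x \<in> Y" "y \<in> Y" "x \<noteq> y" "is_bipartition (Y - {x})" "is_bipartition (Y - {y})"
  shows "is_bipartition Y"
proof -
  have Y: "z \<in> Y - {x} \<or> z \<in> Y - {y}" if "z \<in> Y" for z using assms(3) that by blast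
  show ?thesis
    unfolding is_bipartition_def
  proof (intro conjI ballI allI impI)
    show "finite Y" using assms(4) by (simp add: is_bipartition_def)
    show "case z of (r, c, k) \<Rightarrow> 1 \<le> r \<and> 1 \<le> c \<and> (k = 1 \<or> k = 2)" if "z \<in> Y" for z
      using Y[OF that] assms(4,5) unfolding is_bipartition_def by blast
    fix r c k r' c' assume m: "(r, c, k) \<in> Y" and le: "1 \<le> r'" "r' \<le> r" "1 \<le> c'" "c' \<le> c"
    from Y[OF m] show "(r', c', k) \<in> Y"
      using is_bipartition_closed[OF assms(4) _ le] is_bipartition_closed[OF assms(5) _ le] by blast
  qed
qed

lemma good_residue_inject:
  assumes "good l Y x" "good l Y y" "res l x = res l y"
  shows "x = y"
proof -
  have "\<not> (below x y \<and> below y x)" by (auto simp: below_def split: prod.splits)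
  then show ?thesis using assms unfolding good_def by metis
qed

lemma res_range: "1 \<le> l \<Longrightarrow> res l x \<in> {0..<2 * int l}"
  by (auto simp: res_def split: prod.splits)

lemma reach_range:
  assumes "1 \<le> l" "reach l is Y"
  shows "set is \<subseteq> {0..<2 * int l}"
  using assms(2)
proof induction
  case (reach_step "is" Y x)
  then show ?case using res_range[OF assms(1), of x] by simp
qed simp

lemma reach_last:
  assumes "reach l (is @ [i]) Y"
  shows "\<exists>x. good l Y x \<and> res l x = i"
  using assms by cases auto

lemma shift_shift:
  assumes "1 \<le> l" "a \<in> {0..<2 * int l}"
  shows "shift l (shift l a) = a"
proof -
  have "shift l (shift l a) = (a + int l + int l) mod (2 * int l)"
    unfolding shift_def by (simp add: mod_add_left_eq)
  also have "a + int l + int l = a + 2 * int l" by simp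
  finally show ?thesis using assms(2) by simp
qed

lemma shift_neq:
  assumes "1 \<le> l" "a \<in> {0..<2 * int l}"
  shows "shift l a \<noteq> a"
proof
  assume "shift l a = a"
  then have "(a + int l) mod (2 * int l) = a mod (2 * int l)" using assms(2) by (simp add: shift_def)
  then have "2 * int l dvd int l" by (simp add: mod_eq_dvd_iff)
  then show False using assms(1) zdvd_imp_le[of "2 * int l" "int l"] by simp
qed

lemma count_list_map_inj:
  assumes "inj_on f (insert a (set xs))"
  shows "count_list (map f xs) (f a) = count_list xs a"
  using assms
proof (induction xs)
  case (Cons x xs)
  then show ?case by (auto simp: inj_on_def)
qed simp

theorem theorem3p8:
  fixes l :: nat and h :: "node set \<Rightarrow> node set" and lam :: "node set"
  assumes "l \<ge> 1"
    and "is_h l h"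
    and "kleshchev l lam"
    and "lam \<noteq> h lam"
    and "\<not> almost_symmetric l h lam"
  shows "\<forall>B C. good l lam B \<longrightarrow> good l lam C \<longrightarrow> lam - {B} \<noteq> h (lam - {C})"
proof (intro allI impI notI)
  fix B C assume B: "good l lam B" and C: "good l lam C" and eq: "lam - {B} = h (lam - {C})"
  have rB: "B \<in> lam" "is_bipartition (lam - {B})" and rC: "C \<in> lam" "is_bipartition (lam - {C})"
    using good_removable[OF B] good_removable[OF C] unfolding removable_def by auto
  have ne: "B \<noteq> C" using assms(5) B eq unfolding almost_symmetric_def by blast
  have bip: "is_bipartition lam" by (rule is_bipartition_two_removable[OF rB(1) rC(1) ne rB(2) rC(2)])
  have h_reach: "reach l (map (shift l) is) (h Y)" if "reach l is Y" for "is" Y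
    using assms(2) that unfolding is_h_def by blast
  define i j where "i = res l B" and "j = res l C"
  have ij: "i \<noteq> j" using good_residue_inject[OF B C] ne unfolding i_def j_def by blast
  obtain w where w: "reach l w (lam - {C})"
    using kleshchev_delete_good[OF assms(1,3) bip C] unfolding kleshchev_def by blast
  obtain v where v: "reach l v (lam - {B})"
    using kleshchev_delete_good[OF assms(1,3) bip B] unfolding kleshchev_def by blast
  have wj: "reach l (w @ [j]) lam"
    using reach_step[OF w, of C] C rC by (simp add: insert_absorb j_def)
  have vi: "reach l (v @ [i]) lam"
    using reach_step[OF v, of B] B rB by (simp add: insert_absorb i_def)
  have sw: "reach l (map (shift l) w) (lam - {B})" using h_reach[OF w] eq by simp
  then have swi: "reach l (map (shift l) w @ [i]) lam"
    using reach_step[OF sw, of B] B rB by (simp add: insert_absorb i_def)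
  have w_range: "set w \<subseteq> {0..<2 * int l}" using reach_range[OF assms(1) w] .
  \<comment> \<open>Two paths to \<open>lam\<close>, ending in \<open>j\<close> and in
    \<open>i\<close>, compute the same residue content.\<close>
  have cnt: "count_list w a + of_bool (j = a) = count_list (map (shift l) w) a + of_bool (i = a)" for a
    using reach_count(2)[OF wj, of a] reach_count(2)[OF swi, of a] by (auto split: if_splits)
  have inj: "inj_on (shift l) {0..<2 * int l}"
    by (rule inj_on_inverseI[where g = "shift l"]) (rule shift_shift[OF assms(1)])
  have sh: "count_list (map (shift l) w) (shift l a) = count_list w a" if "a \<in> {0..<2 * int l}" for a
    by (rule count_list_map_inj) (rule inj_on_subset[OF inj], use that w_range in simp)
  have iR: "i \<in> {0..<2 * int l}" using res_range[OF assms(1)] by (simp add: i_def)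
  have si: "shift l i \<in> {0..<2 * int l}" "shift l i \<noteq> i" "shift l (shift l i) = i"
    using shift_shift[OF assms(1) iR] shift_neq[OF assms(1) iR] assms(1) by (auto simp: shift_def)
  \<comment> \<open>Since \<open>shift l\<close> swaps \<open>i\<close> and
    \<open>shift l i\<close>, the counts of these two residues in \<open>w\<close> cancel when the
    two instances of \<open>cnt\<close> are added; what remains is
    \<open>j = shift l i\<close>.\<close>
  have ji: "j = shift l i"
    using cnt[of i] cnt[of "shift l i"] sh[OF iR] sh[OF si(1)] si ij by (cases "j = shift l i") auto
  have hw: "reach l (map (shift l) w @ [i]) (h lam)" using h_reach[OF wj] ji si by simp
  have hv: "reach l (map (shift l) v @ [j]) (h lam)" using h_reach[OF vi] ji by simp
  \<comment> \<open>The paths \<open>hw\<close> and \<open>hv\<close> end in the distinct residues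
    \<open>i\<close> and \<open>j\<close>, so \<open>h lam\<close> has two different good
    nodes.\<close>
  have "is_bipartition (h lam)"
  proof -
    obtain x where x: "good l (h lam) x" "res l x = i" using reach_last[OF hw] by blast
    obtain y where y: "good l (h lam) y" "res l y = j" using reach_last[OF hv] by blast
    have "x \<noteq> y" using x y ij by blast
    then show ?thesis
      using good_removable[OF x(1)] good_removable[OF y(1)] is_bipartition_two_removable[of x "h lam" y]
      unfolding removable_def by blast
  qed
  \<comment> \<open>The paths \<open>hw\<close> and \<open>swi\<close> have the same residue
    sequence.\<close>
  then have "h lam = lam" using reach_unique[OF assms(1) hw swi _ bip] by blast
  then show False using assms(4) by simp
qed

end
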